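(* Let $1<p<\infty$ and $\bar\omega\in\mathbf V$ be fixed. Then there exists a sequence $\{\omega_n\}$ of Yudovich solutions of the vorticity equation such that (1) $\omega_n(0,\cdot)\to\bar\omega$ in $L^p(D)$ as $n\to\infty$; and (2) for any $\tilde\omega\in\mathcal O_{\bar\omega}$ there exists a sequence of times $\{t_n\}\subset\mathbb R$ such that $\omega_n(t_n,\cdot)\to\tilde\omega$ in $L^p(D)$ as $n\to\infty$.
   Context: $D=\{\mathbf x\in\mathbb R^2: |\mathbf x|<1\}$ is the open unit disk, and $(r,\theta)$ are polar coordinates. All functions are real-valued. $\mathcal G$ is the inverse of $-\Delta$ on $D$ with zero Dirichlet boundary condition: $-\Delta\mathcal G\omega=\omega$ in $D$, $\mathcal G\omega=0$ on $\partial D$. Write $\nabla^\perp=(\partial_{x_2},-\partial_{x_1})$. The vorticity equation is $\partial_t\omega+\mathbf v\cdot\nabla\omega=0$ for $t\in\mathbb R$, $\mathbf x\in D$, with $\mathbf v=\nabla^\perp\mathcal G\omega$. Yudovich solution: for $\omega_0\in L^\infty(D)$ there is (Yudovich's theorem) a unique $\omega\in L^\infty(\mathbb R;L^\infty(D))$ such that (1) $\int_{\mathbb R}\int_D\omega(\partial_t\varphi+\nabla^\perp\mathcal G\omega\cdot\nabla\varphi)\,d\mathbf x\,dt=0$ for all $\varphi\in C_c^\infty(\mathbb R\times D)$; (2) $\omega\in C(\mathbb R;L^s(D))$ for all $s\in[1,\infty)$ and $\omega(0,\cdot)=\omega_0$; (3) for every $t\in\mathbb R$, $|\{\omega(t,\cdot)>s\}|=|\{\omega_0>s\}|$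 for all $s\in\mathbb R$ ($|\cdot|$ is Lebesgue measure); (4) $E(\omega(t,\cdot))=E(\omega_0)$ for all $t\in\mathbb R$, where $E(v)=\frac12\int_D v\,\mathcal Gv\,d\mathbf x$. This $\omega$ is called the Yudovich solution with initial vorticity $\omega_0$. $J_n$ is the Bessel function of the first kind of order $n$ and $j$ is the first positive zero of $J_1$. $\mathbf V=\mathrm{span}_{\mathbb R}\{J_0(jr),\,J_1(jr)\cos\theta,\,J_1(jr)\sin\theta\}$, a space of functions on $D$. For $\zeta:D\to\mathbb R$, the rotation orbit is $\mathcal O_\zeta=\{\zeta(r,\theta+\beta): \beta\in\mathbb R\}$. *)

theory Defs
  imports "HOL-Analysis.Analysis"
begin

abbreviation unit_disk :: "(real^2) set" where
  "unit_disk \<equiv> ball 0 1"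

abbreviation disk_measure :: "(real^2) measure" where
  "disk_measure \<equiv> lebesgue_on unit_disk"


section \<open>Differential operators and test functions\<close>

definition partial :: "2 \<Rightarrow> (real^2 \<Rightarrow> real) \<Rightarrow> real^2 \<Rightarrow> real" where
  "partial i f x = frechet_derivative f (at x) (axis i 1)"

definition gradient :: "(real^2 \<Rightarrow> real) \<Rightarrow> real^2 \<Rightarrow> real^2" where
  "gradient f x = vector [partial 1 f x, partial 2 f x]"

definition perp_gradient :: "(real^2 \<Rightarrow> real) \<Rightarrow> real^2 \<Rightarrow> real^2" where
  "perp_gradient f x = vector [partial 2 f x, - partial 1 f x]"

definition laplacian :: "(real^2 \<Rightarrow> real) \<Rightarrow> real^2 \<Rightarrow> real" where
  "laplacian f x = partial 1 (partial 1 f) x + partial 2 (partial 2 f) x"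

primrec C_k :: "nat \<Rightarrow> ('a::euclidean_space \<Rightarrow> real) \<Rightarrow> bool" where
  "C_k 0 f \<longleftrightarrow> continuous_on UNIV f"
| "C_k (Suc k) f \<longleftrightarrow>
     (\<forall>x. f differentiable (at x)) \<and>
     (\<forall>b\<in>Basis. C_k k (\<lambda>x. frechet_derivative f (at x) b))"

text \<open>The space of smooth functions with compact support in the open set \<open>U\<close>.
  Its elements are represented by their extensions by zero, which are smooth on the whole space.\<close>

definition test_functions :: "('a::euclidean_space) set \<Rightarrow> ('a \<Rightarrow> real) set" where
  "test_functions U =
     {\<phi>. (\<forall>k. C_k k \<phi>) \<and> compact (closure {x. \<phi> x \<noteq> 0}) \<and> closure {x. \<phi> x \<noteq> 0} \<subseteq> U}"


section \<open>Lebesgue spaces on the disk\<close>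

text \<open>Elements of \<open>L\<^sup>s(D)\<close> are represented by functions on the plane, whose values
  outside \<open>D\<close> are irrelevant.\<close>

definition Lp_space :: "real \<Rightarrow> (real^2 \<Rightarrow> real) set" where
  "Lp_space s =
     {f. f \<in> borel_measurable disk_measure \<and> integrable disk_measure (\<lambda>x. \<bar>f x\<bar> powr s)}"

definition Lp_norm :: "real \<Rightarrow> (real^2 \<Rightarrow> real) \<Rightarrow> real" where
  "Lp_norm s f = (LINT x|disk_measure. \<bar>f x\<bar> powr s) powr (1 / s)"

definition Linfty_space :: "(real^2 \<Rightarrow> real) set" where
  "Linfty_space =
     {f. f \<in> borel_measurable disk_measure \<and> (\<exists>M. AE x in disk_measure. \<bar>f x\<bar> \<le> M)}"

definition Lp_converges ::
    "real \<Rightarrow> (nat \<Rightarrow> real^2 \<Rightarrow> real) \<Rightarrow> (real^2 \<Rightarrow> real) \<Rightarrow> bool" where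
  "Lp_converges s f g \<longleftrightarrow>
     (\<forall>n. f n \<in> Lp_space s) \<and> g \<in> Lp_space s \<and>
     (\<lambda>n. Lp_norm s (\<lambda>x. f n x - g x)) \<longlonglongrightarrow> 0"

definition continuous_Lp_curve :: "real \<Rightarrow> (real \<Rightarrow> real^2 \<Rightarrow> real) \<Rightarrow> bool" where
  "continuous_Lp_curve s w \<longleftrightarrow>
     (\<forall>t. w t \<in> Lp_space s) \<and>
     (\<forall>t. ((\<lambda>t'. Lp_norm s (\<lambda>x. w t' x - w t x)) \<longlongrightarrow> 0) (at t))"

text \<open>The space \<open>L\<^sup>\<infinity>(\<real>; L\<^sup>\<infinity>(D))\<close>, with measurability understood jointly in time and space.\<close>

definition Linfty_Linfty :: "(real \<Rightarrow> real^2 \<Rightarrow> real) set" where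
  "Linfty_Linfty =
     {w. (\<lambda>(t, x). w t x) \<in> borel_measurable (lebesgue_on (UNIV \<times> unit_disk)) \<and>
         (\<exists>M. AE t in lebesgue. AE x in disk_measure. \<bar>w t x\<bar> \<le> M)}"


section \<open>The vorticity equation\<close>

text \<open>For bounded \<open>w\<close>, \<open>u\<close> solves \<open>-\<Delta>u = w\<close> in \<open>D\<close> in the sense of distributions, and its
  boundary values, attained continuously, are zero. The value 0 is prescribed outside the closed
  disk as well, so that \<open>u\<close> is unique as a function on the plane.\<close>

definition dirichlet_solution :: "(real^2 \<Rightarrow> real) \<Rightarrow> (real^2 \<Rightarrow> real) \<Rightarrow> bool" where
  "dirichlet_solution w u \<longleftrightarrow>
     continuous_on (cball 0 1) u \<and> (\<forall>x. x \<notin> unit_disk \<longrightarrow> u x = 0) \<and>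
     (\<forall>\<phi>\<in>test_functions unit_disk.
        - (LINT x|disk_measure. u x * laplacian \<phi> x) = (LINT x|disk_measure. w x * \<phi> x))"

definition inv_neg_laplacian :: "(real^2 \<Rightarrow> real) \<Rightarrow> real^2 \<Rightarrow> real" where
  "inv_neg_laplacian w = (THE u. dirichlet_solution w u)"

definition energy :: "(real^2 \<Rightarrow> real) \<Rightarrow> real" where
  "energy v = 1/2 * (LINT x|disk_measure. v x * inv_neg_laplacian v x)"

definition weak_vorticity_equation :: "(real \<Rightarrow> real^2 \<Rightarrow> real) \<Rightarrow> bool" where
  "weak_vorticity_equation w \<longleftrightarrow>
     (\<forall>\<phi>\<in>test_functions (UNIV \<times> unit_disk).
        (LINT t|lebesgue. LINT x|disk_measure.
           w t x * (deriv (\<lambda>\<tau>. \<phi> (\<tau>, x)) t +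
                    perp_gradient (inv_neg_laplacian (w t)) x \<bullet> gradient (\<lambda>y. \<phi> (t, y)) x)) = 0)"

definition yudovich_solution :: "(real^2 \<Rightarrow> real) \<Rightarrow> (real \<Rightarrow> real^2 \<Rightarrow> real) \<Rightarrow> bool" where
  "yudovich_solution w0 w \<longleftrightarrow>
     w0 \<in> Linfty_space \<and> w \<in> Linfty_Linfty \<and>
     weak_vorticity_equation w \<and>
     (\<forall>s\<ge>1. continuous_Lp_curve s w) \<and> (AE x in disk_measure. w 0 x = w0 x) \<and>
     (\<forall>t s. measure disk_measure {x \<in> unit_disk. w t x > s} =
            measure disk_measure {x \<in> unit_disk. w0 x > s}) \<and>
     (\<forall>t. energy (w t) = energy w0)"


section \<open>Bessel functions, the space \<open>\<^bold>V\<close> and rotation orbits\<close>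

definition bessel_J :: "nat \<Rightarrow> real \<Rightarrow> real" where
  "bessel_J n x = (\<Sum>k. (-1)^k / (fact k * fact (n + k)) * (x / 2)^(2 * k + n))"

definition bessel_zero :: real where
  "bessel_zero = (LEAST x. 0 < x \<and> bessel_J 1 x = 0)"

definition polar_point :: "real \<Rightarrow> real \<Rightarrow> real^2" where
  "polar_point r \<theta> = vector [r * cos \<theta>, r * sin \<theta>]"

text \<open>At the origin the angle is 0 by convention.\<close>

definition polar_angle :: "real^2 \<Rightarrow> real" where
  "polar_angle x = Arg (Complex (x $ 1) (x $ 2))"

definition V_space :: "(real^2 \<Rightarrow> real) set" where
  "V_space =
     {f. \<exists>a b c. \<forall>x\<in>unit_disk.
        f x = a * bessel_J 0 (bessel_zero * norm x)
            + b * (bessel_J 1 (bessel_zero * norm x) * cos (polar_angle x))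
            + c * (bessel_J 1 (bessel_zero * norm x) * sin (polar_angle x))}"

definition rotation_orbit :: "(real^2 \<Rightarrow> real) \<Rightarrow> (real^2 \<Rightarrow> real) set" where
  "rotation_orbit \<zeta> = {\<lambda>x. \<zeta> (polar_point (norm x) (polar_angle x + \<beta>)) | \<beta>. True}"

end

theory Submission
  imports Defs
begin

text \<open>
  The sequence is explicit. Every \<open>\<omega>bar \<in> V\<close> is steady, because its stream function is
  \<open>\<omega>bar / j\<^sup>2\<close> up to an additive constant: \<open>-\<Delta> \<omega>bar = j\<^sup>2 \<omega>bar\<close>, and on the unit circle the
  two angular modes vanish (as \<open>J\<^sub>1(j) = 0\<close>) while the radial mode is constant. A constant
  vorticity \<open>e\<close> has stream function \<open>e (1 - |x|\<^sup>2) / 4\<close>, whose velocity is rigid rotation with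
  angular speed \<open>e / 2\<close>. Both effects superpose, so the solution with initial vorticity
  \<open>\<omega>bar + e\<close> is \<open>\<omega>bar\<close> rotated by the angle \<open>e t / 2\<close>, plus \<open>e\<close>. However small \<open>e \<noteq> 0\<close> is,
  this solution visits every rotation of \<open>\<omega>bar\<close> up to the constant \<open>e\<close>; letting \<open>e\<close> tend to 0
  gives the instability.

  Most of the work is in verifying that these functions are Yudovich solutions.
  The operator \<open>\<G>\<close> is given by a definite description, so its value is known only once
  weak solutions of the Dirichlet problem are shown to be unique. This is the lemma
  \<open>weakly_harmonic_eq_0\<close>: a continuous function that vanishes outside the disk and is
  weakly harmonic inside is zero. If it took a positive value, its average against a narrow bump
  function, plus a small multiple \<open>e |x|\<^sup>2\<close>, would have an interior maximum. There the second
  difference quotients of the average in both coordinate directions are at most \<open>-2e\<close>; but they can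
  be moved onto the bump function, where their limits add up to the weak Laplacian, which is zero.

  The weak vorticity equation follows from the pointwise conservation law
  \<open>\<partial>\<^sub>t w + \<partial>\<^sub>1 (w v\<^sub>1) + \<partial>\<^sub>2 (w v\<^sub>2) = 0\<close> through integration by parts against test functions in
  space-time. Conservation of the distribution function and of the energy is invariance of
  Lebesgue measure under rotations.

  The Bessel functions enter through the entire functions
  \<open>F\<^sub>n(s) = \<Sum>\<^sub>k (-s)\<^sup>k / (k! (n + k)!)\<close>, for which \<open>J\<^sub>n(x) = (x/2)\<^sup>n F\<^sub>n(x\<^sup>2/4)\<close>. In these terms
  the elements of \<open>V\<close> are smooth functions of the Cartesian coordinates, and all derivatives
  come from \<open>F\<^sub>n' = - F\<^sub>n\<^sub>+\<^sub>1\<close> and \<open>F\<^sub>n = (n + 1) F\<^sub>n\<^sub>+\<^sub>1 - s F\<^sub>n\<^sub>+\<^sub>2\<close>.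
\<close>

section \<open>Integration by parts against test functions\<close>

lemma integral_lborel_translate:
  fixes f :: "'a::euclidean_space \<Rightarrow> real"
  assumes "continuous_on UNIV f"
  shows "(LINT x|lborel. f (x + c)) = (LINT x|lborel. f x)"
proof -
  have [measurable]: "f \<in> borel_measurable borel"
    using assms by (rule borel_measurable_continuous_onI)
  have "distr lborel borel (\<lambda>x. c + x) = (lborel :: 'a measure)"
    using lborel_affine[of 1 c] by (simp add: density_1)
  then have "(LINT x|lborel. f x) = (LINT x|distr lborel borel (\<lambda>x. c + x). f x)"
    by simp
  also have "\<dots> = (LINT x|lborel. f (c + x))"
    by (subst integral_distr) auto
  finally show ?thesis by (simp add: add.commute)
qed

lemma integrable_compact_support:
  fixes f :: "'a::euclidean_space \<Rightarrow> real"
  assumes "continuous_on UNIV f" "compact K" "\<And>x. x \<notin> K \<Longrightarrow> f x = 0"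
  shows "integrable lborel f"
proof -
  have "integrable lborel (\<lambda>x. indicator K x *\<^sub>R f x)"
    using assms(1,2) by (intro borel_integrable_compact) (auto intro: continuous_on_subset)
  moreover have "(\<lambda>x. indicator K x *\<^sub>R f x) = f"
    using assms(3) by (auto simp: fun_eq_iff indicator_def)
  ultimately show ?thesis by simp
qed

text \<open>Directional derivatives everywhere, rather than Frechet derivatives: integration by parts in
  the direction \<open>b\<close> needs no more, and for explicit functions they are one-variable derivatives.\<close>

definition has_dir_deriv ::
    "('a::real_normed_vector \<Rightarrow> real) \<Rightarrow> ('a \<Rightarrow> real) \<Rightarrow> 'a \<Rightarrow> bool" where
  "has_dir_deriv g D b \<longleftrightarrow>
     (\<forall>x. ((\<lambda>t. g (x + t *\<^sub>R b)) has_real_derivative D x) (at 0))"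

lemma has_dir_deriv_line:
  assumes "has_dir_deriv g D b"
  shows "((\<lambda>t. g (x + t *\<^sub>R b)) has_real_derivative D (x + t *\<^sub>R b)) (at t)"
proof -
  have "((\<lambda>s. g ((x + t *\<^sub>R b) + s *\<^sub>R b)) has_real_derivative D (x + t *\<^sub>R b)) (at 0)"
    using assms unfolding has_dir_deriv_def by blast
  then have "((\<lambda>s. g (x + (s + t) *\<^sub>R b)) has_real_derivative D (x + t *\<^sub>R b)) (at 0)"
    by (simp add: algebra_simps)
  then show ?thesis
    using DERIV_shift[of "\<lambda>t. g (x + t *\<^sub>R b)" "D (x + t *\<^sub>R b)" 0 t] by simp
qed

lemma has_dir_deriv_0_outside:
  assumes "has_dir_deriv g D b" "closed K" "\<And>x. x \<notin> K \<Longrightarrow> g x = 0" "x \<notin> K"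
  shows "D x = 0"
proof -
  have "open ((\<lambda>t. x + t *\<^sub>R b) -` (- K))"
    using assms(2) by (intro open_vimage continuous_intros) auto
  then have "eventually (\<lambda>t. t \<in> (\<lambda>t. x + t *\<^sub>R b) -` (- K)) (nhds 0)"
    using assms(4) by (intro eventually_nhds_in_open) auto
  then have ev: "eventually (\<lambda>t. g (x + t *\<^sub>R b) = 0) (nhds 0)"
    by eventually_elim (use assms(3) in auto)
  have "((\<lambda>t. 0::real) has_real_derivative D x) (at 0)"
    using assms(1) DERIV_cong_ev[OF refl ev refl] unfolding has_dir_deriv_def by blast
  then show ?thesis
    using DERIV_unique DERIV_const by blast
qed

lemma bounded_range_compact_support:
  fixes f :: "'a::metric_space \<Rightarrow> real"
  assumes "continuous_on UNIV f" "compact K" "\<And>x. x \<notin> K \<Longrightarrow> f x = 0"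
  obtains B where "0 \<le> B" "\<And>x. \<bar>f x\<bar> \<le> B"
proof -
  have "compact (f ` K)"
    using assms(1,2) by (intro compact_continuous_image) (auto intro: continuous_on_subset)
  then obtain B where B: "\<And>x. x \<in> K \<Longrightarrow> \<bar>f x\<bar> \<le> B"
    by (fastforce dest!: compact_imp_bounded simp: bounded_iff)
  show ?thesis
  proof (rule that[of "\<bar>B\<bar>"])
    fix x show "\<bar>f x\<bar> \<le> \<bar>B\<bar>" 
      using B[of x] assms(3)[of x] by (cases "x \<in> K") auto
  qed simp
qed

text \<open>The difference quotients of \<open>g\<close> have integral 0 by translation invariance, and they converge
  dominatedly to \<open>D\<close>: by the mean value theorem they are values of \<open>D\<close>, which is bounded and
  vanishes off the support of \<open>g\<close>. This replaces Fubini and the fundamental theorem of calculus.\<close>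

lemma integral_dir_deriv_eq_0:
  fixes g :: "'a::euclidean_space \<Rightarrow> real"
  assumes D: "has_dir_deriv g D b" and g: "continuous_on UNIV g" and cD: "continuous_on UNIV D"
    and K: "compact K" "\<And>x. x \<notin> K \<Longrightarrow> g x = 0"
  shows "(LINT x|lborel. D x) = 0"
proof -
  have D0: "D x = 0" if "x \<notin> K" for x
    using has_dir_deriv_0_outside[OF D compact_imp_closed[OF K(1)] K(2) that] .
  obtain B where B: "0 \<le> B" "\<And>x. \<bar>D x\<bar> \<le> B"
    using bounded_range_compact_support[OF cD K(1) D0] by blast
  obtain R where R: "\<And>x. x \<in> K \<Longrightarrow> norm x \<le> R"
    using compact_imp_bounded[OF K(1)] by (auto simp: bounded_iff)
  define h where "h n = inverse (real (Suc n))" for n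
  have h: "0 < h n" "h n \<le> 1" for n
    unfolding h_def by (auto simp: divide_simps)
  have h0: "h \<longlonglongrightarrow> 0"
    unfolding h_def by (rule LIMSEQ_inverse_real_of_nat)
  define q where "q n x = (g (x + h n *\<^sub>R b) - g x) / h n" for n x
  have cq: "continuous_on UNIV (q n)" for n
    unfolding q_def using h(1)[of n] by (auto intro!: continuous_intros continuous_on_compose2[OF g])
  have cg: "continuous_on UNIV (\<lambda>x. g (x + h n *\<^sub>R b))" for n
    by (auto intro!: continuous_intros continuous_on_compose2[OF g])
  have K': "compact ((\<lambda>x. x - c) ` K)" for c
    by (intro compact_continuous_image continuous_intros K(1))
  have ig: "integrable lborel g" "integrable lborel (\<lambda>x. g (x + h n *\<^sub>R b))" for n
  proof -
    show "integrable lborel g" by (rule integrable_compact_support[OF g K])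
    show "integrable lborel (\<lambda>x. g (x + h n *\<^sub>R b))"
    proof (rule integrable_compact_support[OF cg K'[of "h n *\<^sub>R b"]])
      fix x assume "x \<notin> (\<lambda>x. x - h n *\<^sub>R b) ` K"
      then have "x + h n *\<^sub>R b \<notin> K"
        by (metis add_diff_cancel image_eqI)
      then show "g (x + h n *\<^sub>R b) = 0" by (rule K(2))
    qed
  qed
  have q_int: "(LINT x|lborel. q n x) = 0" for n
    unfolding q_def using ig integral_lborel_translate[OF g, of "h n *\<^sub>R b"] by simp
  have q_mvt: "\<exists>t. 0 < t \<and> t < h n \<and> q n x = D (x + t *\<^sub>R b)" for n x
  proof -
    have "\<exists>z. 0 < z \<and> z < h n \<and> g (x + h n *\<^sub>R b) - g (x + 0 *\<^sub>R b) = (h n - 0) * D (x + z *\<^sub>R b)"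
      using h(1) has_dir_deriv_line[OF D] by (intro MVT2) auto
    then show ?thesis
      unfolding q_def using h(1)[of n] by (auto simp: field_simps)
  qed
  have "(\<lambda>n. LINT x|lborel. q n x) \<longlonglongrightarrow> (LINT x|lborel. D x)"
  proof (rule integral_dominated_convergence)
    show "D \<in> borel_measurable lborel" "q n \<in> borel_measurable lborel" for n
      using cD cq[of n] by (auto intro: borel_measurable_continuous_onI)
    have "integrable lborel (\<lambda>x. indicator (cball 0 (R + norm b)) x *\<^sub>R B)"
      by (intro borel_integrable_compact) auto
    then show "integrable lborel (\<lambda>x::'a. B * indicator (cball 0 (R + norm b)) x)"
      by (simp add: mult.commute)
    have "(\<lambda>n. q n x) \<longlonglongrightarrow> D x" for x
    proof -
      have "((\<lambda>t. (g (x + t *\<^sub>R b) - g x) / t) \<longlongrightarrow> D x) (at 0)"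
        using D unfolding has_dir_deriv_def DERIV_def by simp
      moreover have "filterlim h (at 0) sequentially"
        using h0 h(1) by (auto simp: filterlim_at intro!: always_eventually) (metis less_irrefl)
      ultimately show ?thesis
        unfolding q_def by (rule filterlim_compose)
    qed
    then show "AE x in lborel. (\<lambda>n. q n x) \<longlonglongrightarrow> D x" by simp
    show "AE x in lborel. norm (q n x) \<le> B * indicator (cball 0 (R + norm b)) x" for n
    proof (rule AE_I2)
      fix x :: 'a
      obtain t where t: "0 < t" "t < h n" "q n x = D (x + t *\<^sub>R b)"
        using q_mvt by blast
      show "norm (q n x) \<le> B * indicator (cball 0 (R + norm b)) x"
      proof (cases "x + t *\<^sub>R b \<in> K")
        case True
        have "norm x \<le> norm (x + t *\<^sub>R b) + norm (t *\<^sub>R b)"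
          using norm_triangle_ineq4[of "x + t *\<^sub>R b" "t *\<^sub>R b"] by simp
        also have "\<dots> \<le> R + norm b"
        proof -
          have "t * norm b \<le> 1 * norm b"
            using t(1,2) h(2)[of n] by (intro mult_right_mono) auto
          then show ?thesis using R[OF True] t(1) by simp
        qed
        finally show ?thesis using B(2)[of "x + t *\<^sub>R b"] t(3) by (simp add: indicator_def)
      next
        case False
        then show ?thesis using D0 t(3) B(1) by simp
      qed
    qed
  qed
  then show ?thesis
    unfolding q_int by (simp add: LIMSEQ_const_iff)
qed

lemma test_function_C_k: "\<phi> \<in> test_functions U \<Longrightarrow> C_k k \<phi>"
  by (simp add: test_functions_def)

lemma test_function_differentiable: "\<phi> \<in> test_functions U \<Longrightarrow> \<phi> differentiable (at x)"
  using test_function_C_k[of \<phi> U "Suc 0"] by simp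

lemma test_function_continuous: "\<phi> \<in> test_functions U \<Longrightarrow> continuous_on UNIV \<phi>"
  using test_function_C_k[of \<phi> U 0] by simp

lemma DERIV_frechet_line:
  assumes "f differentiable (at x)"
  shows "((\<lambda>t. f (x + t *\<^sub>R b)) has_real_derivative frechet_derivative f (at x) b) (at 0)"
proof -
  have line: "((\<lambda>t. x + t *\<^sub>R b) has_derivative (\<lambda>t. t *\<^sub>R b)) (at (0::real))"
    by (auto intro!: derivative_eq_intros)
  have f: "(f has_derivative frechet_derivative f (at x)) (at (x + (0::real) *\<^sub>R b))"
    using assms by (simp add: frechet_derivative_works[symmetric])
  have "((\<lambda>t. f (x + t *\<^sub>R b)) has_derivative (\<lambda>t. frechet_derivative f (at x) (t *\<^sub>R b))) (at 0)"
    by (rule has_derivative_compose[where f = "\<lambda>t. x + t *\<^sub>R b" and x = 0, OF line f])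
  then show ?thesis
    unfolding has_field_derivative_def linear_scale[OF linear_frechet_derivative[OF assms]]
    by (simp add: mult_commute_abs)
qed

lemma frechet_derivative_eq_dir_deriv:
  assumes "f differentiable (at x)" "((\<lambda>t. f (x + t *\<^sub>R b)) has_real_derivative D) (at 0)"
  shows "frechet_derivative f (at x) b = D"
  using DERIV_frechet_line[OF assms(1)] assms(2) by (rule DERIV_unique)

lemma has_dir_deriv_frechet:
  assumes "\<And>x. f differentiable (at x)"
  shows "has_dir_deriv f (\<lambda>x. frechet_derivative f (at x) b) b"
  unfolding has_dir_deriv_def using DERIV_frechet_line[OF assms] by blast

lemma test_function_support:
  assumes "\<phi> \<in> test_functions U"
  obtains K where "compact K" "K \<subseteq> U" "\<And>x. x \<notin> K \<Longrightarrow> \<phi> x = 0"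
proof (rule that)
  show "compact (closure {x. \<phi> x \<noteq> 0})" "closure {x. \<phi> x \<noteq> 0} \<subseteq> U"
    using assms by (auto simp: test_functions_def)
  show "\<phi> x = 0" if "x \<notin> closure {x. \<phi> x \<noteq> 0}" for x
    using that closure_subset[of "{x. \<phi> x \<noteq> 0}"] by auto
qed

lemma test_functionI:
  assumes "\<And>k. C_k k \<phi>" "compact K" "K \<subseteq> U" "\<And>x. x \<notin> K \<Longrightarrow> \<phi> x = 0"
  shows "\<phi> \<in> test_functions U"
proof -
  have sub: "closure {x. \<phi> x \<noteq> 0} \<subseteq> K"
    using assms(2,4) by (intro closure_minimal compact_imp_closed) auto
  have "compact (closure {x. \<phi> x \<noteq> 0})"
    unfolding compact_eq_bounded_closed
    using bounded_subset[OF compact_imp_bounded[OF assms(2)] sub] by simp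
  with sub show ?thesis
    using assms(1,3) unfolding test_functions_def by blast
qed

lemma test_function_deriv:
  assumes \<phi>: "\<phi> \<in> test_functions U" and b: "b \<in> Basis"
  shows "(\<lambda>x. frechet_derivative \<phi> (at x) b) \<in> test_functions U"
proof -
  obtain K where K: "compact K" "K \<subseteq> U" "\<And>x. x \<notin> K \<Longrightarrow> \<phi> x = 0"
    using test_function_support[OF \<phi>] by blast
  show ?thesis
  proof (rule test_functionI[OF _ K(1,2)])
    show "C_k k (\<lambda>x. frechet_derivative \<phi> (at x) b)" for k
      using test_function_C_k[OF \<phi>, of "Suc k"] b by simp
    show "frechet_derivative \<phi> (at x) b = 0" if "x \<notin> K" for x
      by (rule has_dir_deriv_0_outside[OF has_dir_deriv_frechet
            compact_imp_closed[OF K(1)] K(3) that])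
         (rule test_function_differentiable[OF \<phi>])
  qed
qed

lemma has_dir_deriv_mult:
  assumes "has_dir_deriv f f' b" "has_dir_deriv g g' b"
  shows "has_dir_deriv (\<lambda>x. f x * g x) (\<lambda>x. f x * g' x + f' x * g x) b"
  using assms unfolding has_dir_deriv_def
  by (auto intro!: derivative_eq_intros)

lemma test_function_eq_0: "\<phi> \<in> test_functions U \<Longrightarrow> x \<notin> U \<Longrightarrow> \<phi> x = 0"
  using test_function_support by blast

lemma integrable_mult_test_function:
  fixes f :: "'a::euclidean_space \<Rightarrow> real"
  assumes "continuous_on UNIV f" "\<phi> \<in> test_functions U"
  shows "integrable lborel (\<lambda>x. f x * \<phi> x)"
proof -
  obtain K where "compact K" "K \<subseteq> U" "\<And>x. x \<notin> K \<Longrightarrow> \<phi> x = 0"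
    using test_function_support[OF assms(2)] by blast
  then show ?thesis
    using assms(1) test_function_continuous[OF assms(2)]
    by (intro integrable_compact_support[of _ K] continuous_intros) auto
qed

lemma integration_by_parts_test_function:
  fixes f :: "'a::euclidean_space \<Rightarrow> real"
  assumes \<phi>: "\<phi> \<in> test_functions U" and b: "b \<in> Basis"
    and f: "has_dir_deriv f f' b" "continuous_on UNIV f" "continuous_on UNIV f'"
  shows "(LINT x|lborel. f x * frechet_derivative \<phi> (at x) b) = - (LINT x|lborel. f' x * \<phi> x)"
proof -
  let ?\<phi>' = "\<lambda>x. frechet_derivative \<phi> (at x) b"
  have \<phi>': "?\<phi>' \<in> test_functions U"
    by (rule test_function_deriv[OF \<phi> b])
  obtain K where K: "compact K" "K \<subseteq> U" "\<And>x. x \<notin> K \<Longrightarrow> \<phi> x = 0"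
    using test_function_support[OF \<phi>] by blast
  have "(LINT x|lborel. f x * ?\<phi>' x + f' x * \<phi> x) = 0"
  proof (rule integral_dir_deriv_eq_0)
    show "has_dir_deriv (\<lambda>x. f x * \<phi> x) (\<lambda>x. f x * ?\<phi>' x + f' x * \<phi> x) b"
      by (intro has_dir_deriv_mult f has_dir_deriv_frechet test_function_differentiable[OF \<phi>])
  qed (use K(1,3) f(2,3) test_function_continuous[OF \<phi>] test_function_continuous[OF \<phi>'] in
      \<open>auto intro!: continuous_intros\<close>)
  then show ?thesis
    using integrable_mult_test_function[OF f(2) \<phi>'] integrable_mult_test_function[OF f(3) \<phi>]
    by simp
qed

section \<open>Bump functions\<close>

text \<open>The factors \<open>s\<^sup>-\<^sup>m\<close> are included because differentiating \<open>exp (-1/s)\<close> produces them: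
  the span of these functions is closed under differentiation.\<close>

definition smooth_cutoff :: "nat \<Rightarrow> real \<Rightarrow> real" where
  "smooth_cutoff m s = (if 0 < s then exp (- 1 / s) / s ^ m else 0)"

lemma power_over_fact_le_exp:
  assumes "0 \<le> (x::real)"
  shows "x ^ n / fact n \<le> exp x"
proof -
  have "(\<Sum>k\<in>{n}. x ^ k /\<^sub>R fact k) \<le> (\<Sum>k. x ^ k /\<^sub>R fact k)"
    using assms by (intro sum_le_suminf summable_exp_generic) auto
  then show ?thesis
    by (simp add: exp_def divide_inverse mult.commute)
qed

lemma smooth_cutoff_nonneg: "0 \<le> smooth_cutoff m s"
  by (simp add: smooth_cutoff_def)

text \<open>This linear bound is what makes every derivative at \<open>s = 0\<close> vanish; it comes from the term of
  degree \<open>m + 1\<close> of the exponential series at \<open>1/s\<close>.\<close>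

lemma smooth_cutoff_le: "smooth_cutoff m s \<le> fact (Suc m) * \<bar>s\<bar>"
proof (cases "0 < s")
  case True
  define F :: real where "F = fact (Suc m)"
  have F: "0 < F" unfolding F_def by (rule fact_gt_zero)
  have p: "0 < s ^ Suc m" using True by (rule zero_less_power)
  have "(1 / s) ^ Suc m / F \<le> exp (1 / s)"
    unfolding F_def using True by (intro power_over_fact_le_exp) simp
  then have "1 \<le> exp (1 / s) * (F * s ^ Suc m)"
    using F p by (simp add: power_one_over field_simps)
  then have "exp (- 1 / s) \<le> F * s ^ Suc m"
    by (simp add: exp_minus field_simps)
  then have "exp (- 1 / s) / s ^ m \<le> F * s"
    using True by (simp add: field_simps)
  then show ?thesis
    using True unfolding smooth_cutoff_def F_def by (simp del: fact_Suc)
next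
  case False
  have "0 \<le> fact (Suc m) * \<bar>s\<bar>" by simp
  with False show ?thesis by (simp add: smooth_cutoff_def del: fact_Suc)
qed

lemma DERIV_smooth_cutoff:
  "(smooth_cutoff m has_real_derivative
      (- real m * smooth_cutoff (m + 1) s + smooth_cutoff (m + 2) s)) (at s)"
proof (cases s "0 :: real" rule: linorder_cases)
  case greater
  have ev: "eventually (\<lambda>s. smooth_cutoff m s = exp (- 1 / s) / s ^ m) (nhds s)"
    using eventually_nhds_in_open[of "{0<..}" s] greater
    by (auto elim!: eventually_mono simp: smooth_cutoff_def)
  have "((\<lambda>s. exp (- 1 / s) / s ^ m) has_real_derivative
      (- real m * smooth_cutoff (m + 1) s + smooth_cutoff (m + 2) s)) (at s)"
  proof -
    have pow: "real m * s ^ (m - Suc 0) = real m * s ^ m / s"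
      using greater by (cases m) auto
    have "((\<lambda>s. exp (- 1 / s) / s ^ m) has_real_derivative
        (exp (- 1 / s) * (1 / s\<^sup>2) * s ^ m - exp (- 1 / s) * (real m * s ^ (m - Suc 0))) / (s ^ m * s ^ m)) (at s)"
      using greater by (auto intro!: derivative_eq_intros simp: power2_eq_square)
    also have "(exp (- 1 / s) * (1 / s\<^sup>2) * s ^ m - exp (- 1 / s) * (real m * s ^ (m - Suc 0))) / (s ^ m * s ^ m)
        = - real m * smooth_cutoff (m + 1) s + smooth_cutoff (m + 2) s"
      using greater unfolding pow by (simp add: smooth_cutoff_def field_simps power2_eq_square)
    finally show ?thesis .
  qed
  then show ?thesis
    using DERIV_cong_ev[OF refl ev refl] by blast
next
  case less
  have ev: "eventually (\<lambda>s. smooth_cutoff m s = 0) (nhds s)"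
    using eventually_nhds_in_open[of "{..<0}" s] less
    by (auto elim!: eventually_mono simp: smooth_cutoff_def)
  have "((\<lambda>s. 0::real) has_real_derivative
      (- real m * smooth_cutoff (m + 1) s + smooth_cutoff (m + 2) s)) (at s)"
    using less by (auto simp: smooth_cutoff_def)
  then show ?thesis
    using DERIV_cong_ev[OF refl ev refl] by blast
next
  case equal
  have "(\<lambda>h. smooth_cutoff (m + 1) h) \<midarrow>0\<rightarrow> 0"
  proof (rule tendsto_sandwich[of "\<lambda>_. 0" _ _ "\<lambda>h. fact (Suc (m + 1)) * \<bar>h\<bar>"])
    show "((\<lambda>h::real. fact (Suc (m + 1)) * \<bar>h\<bar>) \<longlongrightarrow> 0) (at 0)"
      by (auto intro!: tendsto_eq_intros)
  qed (auto intro!: always_eventually smooth_cutoff_nonneg smooth_cutoff_le simp del: fact_Suc)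
  moreover have "smooth_cutoff (m + 1) h = smooth_cutoff m h / h" for h
    by (simp add: smooth_cutoff_def)
  ultimately show ?thesis
    unfolding equal DERIV_def by (simp add: smooth_cutoff_def)
qed

text \<open>An algebra of functions that contains the bump function and is closed under directional
  derivatives. Smoothness of all its members then follows by induction on the order, with no
  formula for the higher derivatives of the bump function.\<close>

inductive_set bump_algebra :: "'a::euclidean_space \<Rightarrow> real \<Rightarrow> ('a \<Rightarrow> real) set"
  for c :: 'a and R :: real where
  const: "(\<lambda>_. k) \<in> bump_algebra c R"
| coord: "(\<lambda>x. x \<bullet> b) \<in> bump_algebra c R"
| cutoff: "(\<lambda>x. smooth_cutoff m (R - (x - c) \<bullet> (x - c))) \<in> bump_algebra c R"
| add: "f \<in> bump_algebra c R \<Longrightarrow> g \<in> bump_algebra c R \<Longrightarrow> (\<lambda>x. f x + g x) \<in> bump_algebra c R"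
| mult: "f \<in> bump_algebra c R \<Longrightarrow> g \<in> bump_algebra c R \<Longrightarrow> (\<lambda>x. f x * g x) \<in> bump_algebra c R"

lemma bump_algebra_derivative:
  assumes "f \<in> bump_algebra c R"
  shows "\<exists>f'. (\<forall>x. (f has_derivative f' x) (at x)) \<and> (\<forall>b. (\<lambda>x. f' x b) \<in> bump_algebra c R)"
  using assms
proof induction
  case (const k)
  show ?case
    by (rule exI[of _ "\<lambda>x h. 0"]) (auto intro: bump_algebra.const)
next
  case (coord b)
  show ?case
    by (rule exI[of _ "\<lambda>x h. h \<bullet> b"])
       (auto intro: bump_algebra.const intro!: derivative_eq_intros)
next
  case (cutoff m)
  let ?s = "\<lambda>x. R - (x - c) \<bullet> (x - c)"
  let ?f' = "\<lambda>x h. (- real m * smooth_cutoff (m + 1) (?s x) + smooth_cutoff (m + 2) (?s x))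
      * ((- 2) * (x \<bullet> h + - (c \<bullet> h)))"
  have "((\<lambda>x. smooth_cutoff m (?s x)) has_derivative ?f' x) (at x)" for x
  proof -
    have "(?s has_derivative (\<lambda>h. (- 2) * (x \<bullet> h + - (c \<bullet> h)))) (at x)"
      by (auto intro!: derivative_eq_intros simp: algebra_simps inner_commute)
    from DERIV_compose_FDERIV[OF DERIV_smooth_cutoff this]
    show ?thesis by (simp add: mult.commute)
  qed
  moreover have "(\<lambda>x. ?f' x b) \<in> bump_algebra c R" for b
    by (intro bump_algebra.intros)
  ultimately show ?case
    by (intro exI[of _ ?f']) blast
next
  case (add f g)
  then obtain f' g' where
    f': "\<And>x. (f has_derivative f' x) (at x)" "\<And>b. (\<lambda>x. f' x b) \<in> bump_algebra c R" and
    g': "\<And>x. (g has_derivative g' x) (at x)" "\<And>b. (\<lambda>x. g' x b) \<in> bump_algebra c R"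
    by blast
  show ?case
    by (rule exI[of _ "\<lambda>x h. f' x h + g' x h"])
       (auto intro!: derivative_intros f' g' bump_algebra.add)
next
  case (mult f g)
  then obtain f' g' where
    f': "\<And>x. (f has_derivative f' x) (at x)" "\<And>b. (\<lambda>x. f' x b) \<in> bump_algebra c R" and
    g': "\<And>x. (g has_derivative g' x) (at x)" "\<And>b. (\<lambda>x. g' x b) \<in> bump_algebra c R"
    by blast
  show ?case
    by (rule exI[of _ "\<lambda>x h. f x * g' x h + f' x h * g x"])
       (auto intro!: derivative_intros f' g' bump_algebra.add bump_algebra.mult mult.hyps)
qed

lemma bump_algebra_C_k: "f \<in> bump_algebra c R \<Longrightarrow> C_k k f"
proof (induction k arbitrary: f)
  case 0
  then show ?case
    using bump_algebra_derivative[of f c R]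
    by (auto simp: continuous_on_eq_continuous_within intro: has_derivative_continuous)
next
  case (Suc k)
  then obtain f' where
    f': "\<And>x. (f has_derivative f' x) (at x)" "\<And>b. (\<lambda>x. f' x b) \<in> bump_algebra c R"
    using bump_algebra_derivative by blast
  then have "frechet_derivative f (at x) = f' x" for x
    by (metis frechet_derivative_at)
  then show ?case
    using f' Suc.IH by (auto simp: differentiable_def)
qed

definition bump :: "real \<Rightarrow> 'a::euclidean_space \<Rightarrow> 'a \<Rightarrow> real" where
  "bump \<rho> c x = smooth_cutoff 0 (\<rho>\<^sup>2 - (x - c) \<bullet> (x - c))"

lemma bump_pos_iff:
  assumes "0 < \<rho>"
  shows "0 < bump \<rho> c x \<longleftrightarrow> x \<in> ball c \<rho>"
proof -
  have "(x - c) \<bullet> (x - c) < \<rho>\<^sup>2 \<longleftrightarrow> norm (x - c) < \<rho>"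
    using assms abs_le_square_iff[of \<rho> "norm (x - c)"]
    by (simp add: power2_norm_eq_inner[symmetric] linorder_not_le[symmetric])
  then show ?thesis
    by (simp add: bump_def smooth_cutoff_def dist_norm norm_minus_commute)
qed

lemma bump_nonneg: "0 \<le> bump \<rho> c x"
  by (simp add: bump_def smooth_cutoff_nonneg)

lemma bump_le_1: "bump \<rho> c x \<le> 1"
  by (simp add: bump_def smooth_cutoff_def)

lemma bump_eq_0: "0 < \<rho> \<Longrightarrow> x \<notin> ball c \<rho> \<Longrightarrow> bump \<rho> c x = 0"
  using bump_pos_iff[of \<rho> c x] bump_nonneg[of \<rho> c x] by linarith

lemma bump_translate: "bump \<rho> (c + d) x = bump \<rho> c (x - d)"
  by (simp add: bump_def diff_diff_eq add.commute)

lemma bump_in_test_functions: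
  assumes "0 < \<rho>" "cball c \<rho> \<subseteq> U"
  shows "bump \<rho> c \<in> test_functions U"
proof -
  have "bump \<rho> c \<in> bump_algebra c (\<rho>\<^sup>2)"
    unfolding bump_def[abs_def] by (rule bump_algebra.cutoff)
  then have "C_k k (bump \<rho> c)" for k by (rule bump_algebra_C_k)
  then show ?thesis
    using bump_eq_0[OF assms(1), of _ c] assms(2)
    by (intro test_functionI[of _ "cball c \<rho>"]) auto
qed

lemma continuous_on_bump: 
  assumes "0 < \<rho>" shows "continuous_on UNIV (bump \<rho> (c :: 'a::euclidean_space))"
  by (rule test_function_continuous[OF bump_in_test_functions[OF assms subset_UNIV]])

lemma integrable_bump: "0 < \<rho> \<Longrightarrow> integrable lborel (bump \<rho> c)"
  by (rule integrable_compact_support[OF continuous_on_bump, of _ "cball c \<rho>"])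
     (auto intro!: bump_eq_0)

lemma integral_bump_pos:
  fixes c :: "'a::euclidean_space"
  assumes "0 < \<rho>"
  shows "0 < (LINT x|lborel. bump \<rho> c x)"
proof -
  define k where "k = smooth_cutoff 0 (\<rho>\<^sup>2 - (\<rho>/2)\<^sup>2)"
  have "0 < \<rho>\<^sup>2 - (\<rho>/2)\<^sup>2"
    using assms by (simp add: power2_eq_square)
  then have k: "0 < k" by (simp add: k_def smooth_cutoff_def)
  have le: "k * indicator (cball c (\<rho>/2)) x \<le> bump \<rho> c x" for x
  proof (cases "x \<in> cball c (\<rho>/2)")
    case True
    then have "(norm (x - c))\<^sup>2 \<le> (\<rho>/2)\<^sup>2"
      by (intro power_mono) (auto simp: dist_norm norm_minus_commute)
    then have "- 1 / (\<rho>\<^sup>2 - (\<rho>/2)\<^sup>2) \<le> - 1 / (\<rho>\<^sup>2 - (norm (x - c))\<^sup>2)"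
      using \<open>0 < \<rho>\<^sup>2 - (\<rho>/2)\<^sup>2\<close> by (intro divide_left_mono_neg) auto
    moreover have "0 < \<rho>\<^sup>2 - (norm (x - c))\<^sup>2"
      using \<open>0 < \<rho>\<^sup>2 - (\<rho>/2)\<^sup>2\<close> \<open>(norm (x - c))\<^sup>2 \<le> (\<rho>/2)\<^sup>2\<close> by linarith
    ultimately show ?thesis
      using True \<open>0 < \<rho>\<^sup>2 - (\<rho>/2)\<^sup>2\<close>
      unfolding k_def bump_def smooth_cutoff_def power2_norm_eq_inner by simp
  qed (simp add: bump_nonneg)
  have "0 < k * measure lborel (cball c (\<rho>/2))"
    using k assms by (intro mult_pos_pos) (auto simp: content_cball_pos)
  also have "\<dots> = (LINT x|lborel. k * indicator (cball c (\<rho>/2)) x)"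
    by simp
  also have "\<dots> \<le> (LINT x|lborel. bump \<rho> c x)"
    using le emeasure_compact_finite[of "cball c (\<rho>/2)"]
    by (intro integral_mono integrable_bump assms integrable_mult_right integrable_real_indicator) auto
  finally show ?thesis .
qed

lemma integral_bump_center:
  fixes c :: "'a::euclidean_space"
  shows "0 < \<rho> \<Longrightarrow> (LINT x|lborel. bump \<rho> c x) = (LINT x|lborel. bump \<rho> (0::'a) x)"
  using integral_lborel_translate[OF continuous_on_bump[of \<rho> 0], of "- c"] bump_translate[of \<rho> 0 c]
  by simp

section \<open>Uniqueness for the Dirichlet problem\<close>

lemma second_difference_mean_value:
  assumes f: "has_dir_deriv f f' b" and f': "has_dir_deriv f' f'' b" and h: "0 < h"
  shows "\<exists>t. 0 < t \<and> t < h \<and>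
      f (x + h *\<^sub>R b) + f (x - h *\<^sub>R b) - 2 * f x
        = (f'' (x + t *\<^sub>R b) + f'' (x - t *\<^sub>R b)) / 2 * h\<^sup>2"
proof -
  define G where "G t = f (x + t *\<^sub>R b) + f (x - t *\<^sub>R b)" for t
  define G' where "G' t = f' (x + t *\<^sub>R b) - f' (x - t *\<^sub>R b)" for t
  define G'' where "G'' t = f'' (x + t *\<^sub>R b) + f'' (x - t *\<^sub>R b)" for t
  have reflect: "((\<lambda>t. g (x - t *\<^sub>R b)) has_real_derivative - g' (x - t *\<^sub>R b)) (at t)"
    if "has_dir_deriv g g' b" for g g' t
  proof -
    have "((\<lambda>t. g (x + t *\<^sub>R b)) has_real_derivative g' (x + (- t) *\<^sub>R b)) (at (- t))"
      by (rule has_dir_deriv_line[OF that])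
    then have "((\<lambda>t. g (x + (- t) *\<^sub>R b)) has_real_derivative - g' (x + (- t) *\<^sub>R b)) (at t)"
      by (subst (asm) DERIV_mirror)
    then show ?thesis by simp
  qed
  have G: "(G has_real_derivative G' t) (at t)" "(G' has_real_derivative G'' t) (at t)" for t
    unfolding G_def G'_def G''_def
    using has_dir_deriv_line[OF f, of x t] has_dir_deriv_line[OF f', of x t]
      reflect[OF f, of t] reflect[OF f', of t]
    by (auto intro!: derivative_eq_intros)
  define d where "d m = (if m = 0 then G else if m = 1 then G' else G'')" for m :: nat
  have "\<exists>t>0. t < h \<and> G h = (\<Sum>m<2. d m 0 / fact m * h ^ m) + d 2 t / fact 2 * h ^ 2"
    by (rule Maclaurin[OF h]) (auto simp: d_def less_2_cases_iff G)
  then obtain t where t: "0 < t" "t < h"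
    and "G h = (\<Sum>m<2. d m 0 / fact m * h ^ m) + d 2 t / fact 2 * h ^ 2"
    by blast
  then have "G h = G 0 + G' 0 * h + G'' t / 2 * h\<^sup>2"
    by (simp add: d_def numeral_2_eq_2)
  moreover have "G' 0 = 0" "G 0 = 2 * f x" by (simp_all add: G'_def G_def)
  ultimately show ?thesis
    using t unfolding G_def G''_def by (intro exI[of _ t]) simp
qed

text \<open>The mean value form writes the second difference quotient of \<open>\<phi>\<close> as a mean of two values of
  its second derivative, which gives both the pointwise limit and the uniform bound needed for
  dominated convergence. Only \<open>\<phi>\<close> is differentiated, so \<open>v\<close> may be merely continuous.\<close>

lemma weak_second_difference_limit:
  fixes v :: "'a::euclidean_space \<Rightarrow> real"
  assumes v: "continuous_on UNIV v" "compact K" "\<And>x. x \<notin> K \<Longrightarrow> v x = 0"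
    and \<phi>: "\<phi> \<in> test_functions U" and b: "b \<in> Basis"
    and h: "\<And>n. 0 < h n" "h \<longlonglongrightarrow> 0"
  defines "D\<phi> \<equiv> \<lambda>x. frechet_derivative \<phi> (at x) b"
  shows "(\<lambda>n. (LINT x|lborel. v x * (\<phi> (x + h n *\<^sub>R b) + \<phi> (x - h n *\<^sub>R b) - 2 * \<phi> x)) / (h n)\<^sup>2)
      \<longlonglongrightarrow> (LINT x|lborel. v x * frechet_derivative D\<phi> (at x) b)"
proof -
  let ?DD = "\<lambda>x. frechet_derivative D\<phi> (at x) b"
  have D: "D\<phi> \<in> test_functions U"
    unfolding D\<phi>_def by (rule test_function_deriv[OF \<phi> b])
  have DD: "?DD \<in> test_functions U"
    by (rule test_function_deriv[OF D b])
  have cont: "continuous_on UNIV \<phi>" "continuous_on UNIV ?DD"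
    using test_function_continuous[OF \<phi>] test_function_continuous[OF DD] by auto
  have dd: "has_dir_deriv \<phi> D\<phi> b" "has_dir_deriv D\<phi> ?DD b"
    unfolding D\<phi>_def
    using has_dir_deriv_frechet[OF test_function_differentiable[OF \<phi>]]
      has_dir_deriv_frechet[OF test_function_differentiable[OF D]] unfolding D\<phi>_def by auto
  obtain B where B: "0 \<le> B" "\<And>x. \<bar>?DD x\<bar> \<le> B"
  proof -
    obtain K' where "compact K'" "K' \<subseteq> U" "\<And>x. x \<notin> K' \<Longrightarrow> ?DD x = 0"
      by (rule test_function_support[OF DD]) blast
    from bounded_range_compact_support[OF cont(2) this(1) this(3)] that show ?thesis by blast
  qed
  define q where "q n x = (\<phi> (x + h n *\<^sub>R b) + \<phi> (x - h n *\<^sub>R b) - 2 * \<phi> x) / (h n)\<^sup>2" for n x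
  have cq: "continuous_on UNIV (q n)" for n
    unfolding q_def using h(1)[of n]
    by (auto intro!: continuous_intros continuous_on_compose2[OF cont(1)])
  have q: "\<exists>t. 0 < t \<and> t < h n \<and> q n x = (?DD (x + t *\<^sub>R b) + ?DD (x - t *\<^sub>R b)) / 2" for n x
    using second_difference_mean_value[OF dd h(1)[of n], of x] h(1)[of n]
    unfolding q_def by (auto simp: field_simps)
  have lim: "(\<lambda>n. q n x) \<longlonglongrightarrow> ?DD x" for x
  proof -
    obtain t where t: "\<And>n. 0 < t n \<and> t n < h n"
      and qt: "\<And>n. q n x = (?DD (x + t n *\<^sub>R b) + ?DD (x - t n *\<^sub>R b)) / 2"
      using q[of _ x] by metis
    have "t \<longlonglongrightarrow> 0"
      by (rule tendsto_sandwich[OF _ _ tendsto_const h(2)])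
         (use t in \<open>auto intro!: always_eventually less_imp_le\<close>)
    then have xt: "(\<lambda>n. x + t n *\<^sub>R b) \<longlonglongrightarrow> x" "(\<lambda>n. x - t n *\<^sub>R b) \<longlonglongrightarrow> x"
      by (auto intro!: tendsto_eq_intros)
    have "isCont ?DD x"
      using cont(2) by (simp add: continuous_on_eq_continuous_at)
    then have "(\<lambda>n. (?DD (x + t n *\<^sub>R b) + ?DD (x - t n *\<^sub>R b)) / 2) \<longlonglongrightarrow> (?DD x + ?DD x) / 2"
      by (intro tendsto_intros isCont_tendsto_compose[OF _ xt(1)] isCont_tendsto_compose[OF _ xt(2)]) auto
    then show ?thesis unfolding qt by simp
  qed
  have "(\<lambda>n. LINT x|lborel. v x * q n x) \<longlonglongrightarrow> (LINT x|lborel. v x * ?DD x)"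
  proof (rule integral_dominated_convergence)
    show "(\<lambda>x. v x * ?DD x) \<in> borel_measurable lborel" "(\<lambda>x. v x * q n x) \<in> borel_measurable lborel" for n
      using v(1) cont(2) cq[of n] by (auto intro!: borel_measurable_continuous_onI continuous_intros)
    show "integrable lborel (\<lambda>x. B * \<bar>v x\<bar>)"
      using v by (intro integrable_compact_support[of _ K] continuous_intros) auto
    show "AE x in lborel. (\<lambda>n. v x * q n x) \<longlonglongrightarrow> v x * ?DD x"
      using lim by (auto intro!: tendsto_intros)
    show "AE x in lborel. norm (v x * q n x) \<le> B * \<bar>v x\<bar>" for n
    proof (rule AE_I2)
      fix x
      obtain t where "q n x = (?DD (x + t *\<^sub>R b) + ?DD (x - t *\<^sub>R b)) / 2" using q by blast
      then have "\<bar>q n x\<bar> \<le> B"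
        using B(2)[of "x + t *\<^sub>R b"] B(2)[of "x - t *\<^sub>R b"] by (simp add: abs_le_iff)
      then show "norm (v x * q n x) \<le> B * \<bar>v x\<bar>"
        using mult_right_mono[OF _ abs_ge_zero[of "v x"]] by (simp add: abs_mult mult.commute[of "\<bar>v x\<bar>"])
    qed
  qed
  then show ?thesis
    unfolding q_def by simp
qed

lemma test_function_partial: "\<phi> \<in> test_functions U \<Longrightarrow> partial i \<phi> \<in> test_functions U"
  using test_function_deriv[of \<phi> U "axis i 1"] axis_in_Basis_iff[of i "1::real"]
  by (simp add: partial_def[abs_def])

lemma partial_partial: "partial i (partial i \<phi>) x
    = frechet_derivative (\<lambda>x. frechet_derivative \<phi> (at x) (axis i 1)) (at x) (axis i 1)"
  by (simp add: partial_def[abs_def])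

text \<open>Mollification of \<open>v\<close>, written without assuming a normalised bump function.\<close>

definition bump_average :: "real \<Rightarrow> ('a::euclidean_space \<Rightarrow> real) \<Rightarrow> 'a \<Rightarrow> real" where
  "bump_average \<rho> v c = (LINT y|lborel. v y * bump \<rho> c y) / (LINT y|lborel. bump \<rho> (0::'a) y)"

lemma integrable_mult_bump:
  fixes v :: "'a::euclidean_space \<Rightarrow> real"
  assumes "continuous_on UNIV v" "0 < \<rho>"
  shows "integrable lborel (\<lambda>y. v y * bump \<rho> c y)"
  using integrable_mult_test_function[OF assms(1) bump_in_test_functions[OF assms(2) subset_UNIV]] .

lemma bump_average_close:
  fixes v :: "'a::euclidean_space \<Rightarrow> real"
  assumes v: "continuous_on UNIV v" and \<rho>: "0 < \<rho>" and e: "\<And>y. y \<in> ball c \<rho> \<Longrightarrow> \<bar>v y - v c\<bar> \<le> e"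
  shows "\<bar>bump_average \<rho> v c - v c\<bar> \<le> e"
proof -
  define I where "I = (LINT y|lborel. bump \<rho> (0::'a) y)"
  have I: "0 < I" unfolding I_def by (rule integral_bump_pos[OF \<rho>])
  have Ic: "(LINT y|lborel. bump \<rho> c y) = I"
    unfolding I_def by (rule integral_bump_center[OF \<rho>])
  have "I * (bump_average \<rho> v c - v c) = (LINT y|lborel. v y * bump \<rho> c y) - v c * (LINT y|lborel. bump \<rho> c y)"
    using I unfolding Ic bump_average_def I_def[symmetric] by (simp add: field_simps)
  also have "\<dots> = (LINT y|lborel. (v y - v c) * bump \<rho> c y)"
    using integrable_mult_bump[OF v \<rho>, of c] integrable_bump[OF \<rho>, of c]
    by (simp add: left_diff_distrib)
  also have "\<bar>\<dots>\<bar> \<le> (LINT y|lborel. \<bar>(v y - v c) * bump \<rho> c y\<bar>)"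
    by (rule integral_abs_bound)
  also have "\<dots> \<le> (LINT y|lborel. e * bump \<rho> c y)"
  proof (rule integral_mono)
    show "integrable lborel (\<lambda>y. \<bar>(v y - v c) * bump \<rho> c y\<bar>)"
      using v by (intro integrable_abs integrable_mult_bump \<rho> continuous_intros)
    show "integrable lborel (\<lambda>y. e * bump \<rho> c y)"
      using integrable_bump[OF \<rho>, of c] by simp
    show "\<bar>(v y - v c) * bump \<rho> c y\<bar> \<le> e * bump \<rho> c y" for y
      using e[of y] bump_eq_0[OF \<rho>, of y c] bump_nonneg[of \<rho> c y]
      by (cases "y \<in> ball c \<rho>") (auto simp: abs_mult intro: mult_right_mono)
  qed
  also have "\<dots> = e * I" using Ic by simp
  finally show ?thesis
    using I by (simp add: abs_mult mult.commute)
qed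

lemma continuous_on_bump_average:
  fixes v :: "'a::euclidean_space \<Rightarrow> real"
  assumes v: "continuous_on UNIV v" "compact K" "\<And>x. x \<notin> K \<Longrightarrow> v x = 0" and \<rho>: "0 < \<rho>"
  shows "continuous_on UNIV (bump_average \<rho> v)"
proof -
  have "(\<lambda>n. LINT y|lborel. v y * bump \<rho> (c n) y) \<longlonglongrightarrow> (LINT y|lborel. v y * bump \<rho> l y)"
    if c: "c \<longlonglongrightarrow> l" for c l
  proof (rule integral_dominated_convergence)
    show "(\<lambda>y. v y * bump \<rho> l y) \<in> borel_measurable lborel"
      "(\<lambda>y. v y * bump \<rho> (c n) y) \<in> borel_measurable lborel" for n
      using v(1) continuous_on_bump[OF \<rho>, of l] continuous_on_bump[OF \<rho>, of "c n"]
      by (auto intro!: borel_measurable_continuous_onI continuous_intros)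
    show "integrable lborel (\<lambda>y. \<bar>v y\<bar>)"
      using v by (intro integrable_compact_support[of _ K] continuous_intros) auto
    have "(\<lambda>n. bump \<rho> (c n) y) \<longlonglongrightarrow> bump \<rho> l y" for y
    proof -
      have "isCont (bump \<rho> 0) (y - l)"
        using continuous_on_bump[OF \<rho>, of "0::'a"] by (simp add: continuous_on_eq_continuous_at)
      then have "(\<lambda>n. bump \<rho> 0 (y - c n)) \<longlonglongrightarrow> bump \<rho> 0 (y - l)"
        by (rule isCont_tendsto_compose) (intro tendsto_intros c)
      then show ?thesis
        by (simp add: bump_def)
    qed
    then show "AE y in lborel. (\<lambda>n. v y * bump \<rho> (c n) y) \<longlonglongrightarrow> v y * bump \<rho> l y"
      by (auto intro!: tendsto_intros)
    show "AE y in lborel. norm (v y * bump \<rho> (c n) y) \<le> \<bar>v y\<bar>" for n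
      using bump_nonneg[of \<rho> "c n"] bump_le_1[of \<rho> "c n"]
      by (auto simp: abs_mult intro!: mult_left_le)
  qed
  then have "(bump_average \<rho> v \<circ> c) \<longlonglongrightarrow> bump_average \<rho> v l" if "c \<longlonglongrightarrow> l" for c l
    unfolding bump_average_def o_def using that integral_bump_pos[OF \<rho>, of "0::'a"]
    by (intro tendsto_intros) auto
  then show ?thesis
    by (auto simp: continuous_on_sequentially)
qed

lemma sum_le_rearrange:
  fixes V0 V1 V2 A0 A1 A2 k :: real
  assumes "V1 + A1 + (V2 + A2) \<le> 2 * (V0 + A0)" "A1 + A2 = 2 * A0 + k"
  shows "V1 + V2 - 2 * V0 \<le> - k"
  using assms by (simp add: algebra_simps)

text \<open>The maximum principle for the mollification of \<open>v\<close>. Within distance \<open>\<rho>\<close> of the boundary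
  \<open>v\<close> is at most \<open>e\<close> by uniform continuity, and the mollification differs from \<open>v\<close> by at most
  \<open>e\<close>. On the smaller disk of radius \<open>1 - \<rho>\<close> the bump functions are admissible test functions,
  and the mollification plus \<open>e |c|\<^sup>2\<close> has no interior maximum, hence is at most \<open>3e\<close>, its
  bound on the circle of radius \<open>1 - \<rho>\<close>.\<close>

lemma weakly_harmonic_le:
  assumes v: "continuous_on UNIV v" "\<And>x. x \<notin> unit_disk \<Longrightarrow> v x = 0"
    and harmonic: "\<And>\<phi>. \<phi> \<in> test_functions unit_disk \<Longrightarrow> (LINT x|lborel. v x * laplacian \<phi> x) = 0"
    and e: "0 < e"
  shows "v x \<le> 4 * e"
proof -
  have v0: "v x = 0" if "x \<notin> cball 0 1" for x using v(2) that by auto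
  have "uniformly_continuous_on (cball 0 3) v"
    by (rule compact_uniformly_continuous) (auto intro: continuous_on_subset[OF v(1)])
  then obtain d where d: "0 < d"
    and dv: "\<And>x y. x \<in> cball 0 3 \<Longrightarrow> y \<in> cball 0 3 \<Longrightarrow> dist y x < d \<Longrightarrow> dist (v y) (v x) < e"
    unfolding uniformly_continuous_on_def using e by metis
  \<comment> \<open>Less than \<open>d\<close>, so that \<open>v\<close> oscillates by less than \<open>e\<close> on \<open>\<rho>\<close>-balls; at most \<open>1/2\<close>, so that
      the smaller disk is not empty.\<close>
  define \<rho> where "\<rho> = min d 1 / 2"
  have \<rho>: "0 < \<rho>" "\<rho> \<le> 1/2" "\<rho> < d" using d by (auto simp: \<rho>_def)
  define I where "I = (LINT y|lborel. bump \<rho> (0::real^2) y)"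
  have I: "0 < I" unfolding I_def by (rule integral_bump_pos[OF \<rho>(1)])
  let ?V = "bump_average \<rho> v"
  have close: "\<bar>?V c - v c\<bar> \<le> e" if "norm c \<le> 1" for c
  proof (rule bump_average_close[OF v(1) \<rho>(1)])
    fix y assume y: "y \<in> ball c \<rho>"
    have "norm y \<le> norm c + dist c y"
      using norm_triangle_ineq4[of c "c - y"] by (simp add: dist_norm)
    then show "\<bar>v y - v c\<bar> \<le> e"
      using y that \<rho> dv[of c y] by (auto simp: dist_real_def dist_commute)
  qed
  have near_boundary: "v c \<le> e" if "1 - \<rho> \<le> norm c" for c
  proof (cases "norm c < 1")
    case True
    define z where "z = c /\<^sub>R norm c"
    have c0: "0 < norm c" using that \<rho>(2) by linarith
    have "dist c z = 1 - norm c"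
    proof -
      have "c - z = (norm c - 1) *\<^sub>R z"
        unfolding z_def using c0 by (simp add: algebra_simps)
      moreover have "norm z = 1" using c0 by (simp add: z_def)
      ultimately show ?thesis using True by (simp add: dist_norm)
    qed
    moreover have "v z = 0" using c0 by (intro v(2)) (simp add: z_def)
    moreover have "norm z \<le> 3" using c0 by (simp add: z_def)
    ultimately show ?thesis
      using dv[of z c] True that \<rho>(3) by (auto simp: dist_real_def)
  next
    case False
    then show ?thesis using v(2)[of c] e by simp
  qed
  define w where "w c = ?V c + e * (c \<bullet> c)" for c
  have cw: "continuous_on (cball 0 (1 - \<rho>)) w"
    unfolding w_def
    by (intro continuous_intros continuous_on_subset[OF continuous_on_bump_average[OF v(1) compact_cball[of 0 1] v0 \<rho>(1)]]) auto
  obtain c where c: "c \<in> cball 0 (1 - \<rho>)" "\<And>y. y \<in> cball 0 (1 - \<rho>) \<Longrightarrow> w y \<le> w c"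
    using continuous_attains_sup[OF compact_cball _ cw] \<rho> by auto
  have "norm c = 1 - \<rho>"
  proof (rule ccontr)
    assume "norm c \<noteq> 1 - \<rho>"
    then have c1: "norm c < 1 - \<rho>" using c(1) by simp
    define \<phi> where "\<phi> = bump \<rho> c"
    have \<phi>: "\<phi> \<in> test_functions unit_disk"
      unfolding \<phi>_def
    proof (rule bump_in_test_functions[OF \<rho>(1)])
      show "cball c \<rho> \<subseteq> unit_disk"
      proof
        fix y assume "y \<in> cball c \<rho>"
        then show "y \<in> unit_disk"
          using c1 norm_triangle_ineq4[of c "c - y"] by (simp add: dist_norm)
      qed
    qed
    \<comment> \<open>Step sizes for which \<open>c \<plusminus> h n b\<close> stays in the smaller disk, where \<open>c\<close> is maximal.\<close>
    define h where "h n = (1 - \<rho> - norm c) * inverse (real (Suc n))" for n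
    have h: "0 < h n" for n using c1 by (simp add: h_def)
    have hle: "h n \<le> 1 - \<rho> - norm c" for n
      unfolding h_def using c1 by (intro mult_left_le) (auto simp: inverse_eq_divide)
    have h0: "h \<longlonglongrightarrow> 0"
      unfolding h_def using tendsto_mult_left[OF LIMSEQ_inverse_real_of_nat, of "1 - \<rho> - norm c"] by simp
    let ?L = "\<lambda>i. LINT x|lborel. v x * partial i (partial i \<phi>) x"
    have L: "?L i \<le> - 2 * e * I" for i
    proof -
      define b :: "real^2" where "b = axis i 1"
      have b: "norm b = 1" "b \<in> Basis" by (simp_all add: b_def axis_in_Basis_iff)
      have "(LINT x|lborel. v x * (\<phi> (x + h n *\<^sub>R b) + \<phi> (x - h n *\<^sub>R b) - 2 * \<phi> x)) / (h n)\<^sup>2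
          \<le> - 2 * e * I" for n
      proof -
        have in_ball: "c + s *\<^sub>R b \<in> cball 0 (1 - \<rho>)" if "\<bar>s\<bar> = h n" for s
          using norm_triangle_ineq[of c "s *\<^sub>R b"] hle[of n] b(1) that by simp
        have "w (c + h n *\<^sub>R b) + w (c + (- h n) *\<^sub>R b) \<le> 2 * w c"
          using c(2)[OF in_ball[of "h n"]] c(2)[OF in_ball[of "- h n"]] h[of n] by simp
        moreover have "(c + h n *\<^sub>R b) \<bullet> (c + h n *\<^sub>R b) + (c + (- h n) *\<^sub>R b) \<bullet> (c + (- h n) *\<^sub>R b)
            = 2 * (c \<bullet> c) + 2 * (h n)\<^sup>2"
          using b(1) by (simp add: inner_simps power2_eq_square norm_eq_1 algebra_simps)
        then have "e * ((c + h n *\<^sub>R b) \<bullet> (c + h n *\<^sub>R b)) + e * ((c + (- h n) *\<^sub>R b) \<bullet> (c + (- h n) *\<^sub>R b))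
            = 2 * (e * (c \<bullet> c)) + 2 * e * (h n)\<^sup>2"
          unfolding distrib_left[symmetric] by (simp add: distrib_left)
        ultimately have "?V (c + h n *\<^sub>R b) + ?V (c + (- h n) *\<^sub>R b) - 2 * ?V c \<le> - (2 * e * (h n)\<^sup>2)"
          unfolding w_def by (rule sum_le_rearrange)
        moreover have "I * (?V (c + h n *\<^sub>R b) + ?V (c + (- h n) *\<^sub>R b) - 2 * ?V c)
            = (LINT x|lborel. v x * (\<phi> (x + h n *\<^sub>R b) + \<phi> (x - h n *\<^sub>R b) - 2 * \<phi> x))"
        proof -
          have shift: "bump \<rho> (c + h n *\<^sub>R b) x = \<phi> (x - h n *\<^sub>R b)"
            "bump \<rho> (c + (- h n) *\<^sub>R b) x = \<phi> (x + h n *\<^sub>R b)" for x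
            unfolding \<phi>_def bump_translate by simp_all
          have int: "integrable lborel (\<lambda>x. v x * \<phi> x)" "integrable lborel (\<lambda>x. v x * \<phi> (x - h n *\<^sub>R b))"
            "integrable lborel (\<lambda>x. v x * \<phi> (x + h n *\<^sub>R b))"
            using integrable_mult_bump[OF v(1) \<rho>(1), of c]
              integrable_mult_bump[OF v(1) \<rho>(1), of "c + h n *\<^sub>R b"]
              integrable_mult_bump[OF v(1) \<rho>(1), of "c + (- h n) *\<^sub>R b"]
            unfolding shift \<phi>_def[symmetric] by auto
          have "I * ?V z = (LINT y|lborel. v y * bump \<rho> z y)" for z
            using I unfolding bump_average_def I_def by simp
          then have "I * (?V (c + h n *\<^sub>R b) + ?V (c + (- h n) *\<^sub>R b) - 2 * ?V c)
            = (LINT x|lborel. v x * \<phi> (x - h n *\<^sub>R b)) + (LINT x|lborel. v x * \<phi> (x + h n *\<^sub>R b)) - 2 * (LINT x|lborel. v x * \<phi> x)"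
            unfolding shift[symmetric] by (simp add: \<phi>_def algebra_simps)
          also have "\<dots> = (LINT x|lborel. v x * (\<phi> (x + h n *\<^sub>R b) + \<phi> (x - h n *\<^sub>R b) - 2 * \<phi> x))"
          proof -
            have "(\<lambda>x. v x * (\<phi> (x + h n *\<^sub>R b) + \<phi> (x - h n *\<^sub>R b) - 2 * \<phi> x))
              = (\<lambda>x. v x * \<phi> (x - h n *\<^sub>R b) + v x * \<phi> (x + h n *\<^sub>R b) - 2 * (v x * \<phi> x))"
              by (simp add: algebra_simps)
            then show ?thesis using int by simp
          qed
          finally show ?thesis .
        qed
        ultimately have "(LINT x|lborel. v x * (\<phi> (x + h n *\<^sub>R b) + \<phi> (x - h n *\<^sub>R b) - 2 * \<phi> x)) \<le> I * - (2 * e * (h n)\<^sup>2)"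
          using mult_left_mono[OF _ less_imp_le[OF I]] by (metis (lifting))
        then show ?thesis using h[of n] by (simp add: pos_divide_le_eq mult_ac)
      qed
      then show ?thesis
        unfolding partial_partial b_def[symmetric]
        using weak_second_difference_limit[OF v(1) compact_cball[of 0 1] v0 \<phi> b(2) h h0]
        by (intro LIMSEQ_le_const2) auto
    qed
    have "integrable lborel (\<lambda>x. v x * partial i (partial i \<phi>) x)" for i
      by (rule integrable_mult_test_function[OF v(1) test_function_partial[OF test_function_partial[OF \<phi>]]])
    then have "(LINT x|lborel. v x * laplacian \<phi> x) = ?L 1 + ?L 2"
      unfolding laplacian_def by (simp add: distrib_left)
    moreover have "?L 1 \<le> - 2 * (e * I)" "?L 2 \<le> - 2 * (e * I)"
      using L[of 1] L[of 2] by (simp_all only: mult.assoc)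
    ultimately have "e * I \<le> 0"
      using harmonic[OF \<phi>] by linarith
    then show False using mult_pos_pos[OF e I] by simp
  qed
  then have "w c \<le> 3 * e"
  proof -
    have "?V c \<le> 2 * e"
      using close[of c] near_boundary[of c] \<open>norm c = 1 - \<rho>\<close> \<rho>(1) by auto
    moreover have "c \<bullet> c \<le> 1"
      using \<open>norm c = 1 - \<rho>\<close> \<rho> by (simp add: power2_norm_eq_inner[symmetric] power_le_one)
    ultimately show ?thesis
      unfolding w_def using e mult_left_mono[of "c \<bullet> c" 1 e] by linarith
  qed
  show ?thesis
  proof (cases "norm x \<le> 1 - \<rho>")
    case True
    then have "w x \<le> 3 * e" using c(2)[of x] \<open>w c \<le> 3 * e\<close> by simp
    then have "?V x \<le> 3 * e" unfolding w_def using mult_nonneg_nonneg[OF less_imp_le[OF e] inner_ge_zero[of x]] by linarith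
    then show ?thesis using close[of x] True \<rho>(1) by auto
  next
    case False
    then show ?thesis using near_boundary[of x] e by simp
  qed
qed

lemma weakly_harmonic_eq_0:
  assumes v: "continuous_on UNIV v" "\<And>x. x \<notin> unit_disk \<Longrightarrow> v x = 0"
    and harmonic: "\<And>\<phi>. \<phi> \<in> test_functions unit_disk \<Longrightarrow> (LINT x|lborel. v x * laplacian \<phi> x) = 0"
  shows "v x = 0"
proof -
  have le: "u x \<le> 0"
    if u: "continuous_on UNIV u" "\<And>x. x \<notin> unit_disk \<Longrightarrow> u x = 0"
      "\<And>\<phi>. \<phi> \<in> test_functions unit_disk \<Longrightarrow> (LINT x|lborel. u x * laplacian \<phi> x) = 0" for u
  proof (rule field_le_epsilon)
    fix e :: real assume "0 < e"
    then show "u x \<le> 0 + e"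
      using weakly_harmonic_le[OF u, of "e / 4" x] by simp
  qed
  have "v x \<le> 0"
    by (rule le[OF v harmonic])
  moreover have "- v x \<le> 0"
    by (rule le[of "\<lambda>x. - v x"]) (simp_all add: v harmonic continuous_on_minus)
  ultimately show ?thesis by simp
qed

lemma disk_integral_eq_lborel:
  fixes g :: "real^2 \<Rightarrow> real"
  assumes "continuous_on UNIV g" "\<And>x. x \<notin> unit_disk \<Longrightarrow> g x = 0"
  shows "(LINT x|disk_measure. g x) = (LINT x|lborel. g x)"
proof -
  have "(LINT x|disk_measure. g x) = (LINT x|lebesgue. indicator unit_disk x *\<^sub>R g x)"
    by (rule integral_restrict_space) simp
  also have "(\<lambda>x. indicator unit_disk x *\<^sub>R g x) = g"
    using assms(2) by (auto simp: fun_eq_iff indicator_def)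
  also have "(LINT x|lebesgue. g x) = (LINT x|lborel. g x)"
    using assms(1) by (intro integral_completion) (simp add: borel_measurable_continuous_onI)
  finally show ?thesis .
qed

lemma disk_integral_mult_test_function:
  fixes f :: "real^2 \<Rightarrow> real"
  assumes "continuous_on UNIV f" "\<phi> \<in> test_functions unit_disk"
  shows "(LINT x|disk_measure. f x * \<phi> x) = (LINT x|lborel. f x * \<phi> x)"
  using assms(1) test_function_continuous[OF assms(2)] test_function_eq_0[OF assms(2)]
  by (intro disk_integral_eq_lborel continuous_intros) auto

lemma disk_integral_cong:
  "(\<And>x. x \<in> unit_disk \<Longrightarrow> f x = g x) \<Longrightarrow> (LINT x|disk_measure. f x) = (LINT x|disk_measure. g x)"
  by (rule Bochner_Integration.integral_cong) auto

lemma laplacian_test_function_integral: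
  fixes f :: "real^2 \<Rightarrow> real"
  assumes f: "continuous_on UNIV f" and \<phi>: "\<phi> \<in> test_functions unit_disk"
  shows "(LINT x|disk_measure. f x * laplacian \<phi> x) = (LINT x|lborel. f x * laplacian \<phi> x)"
    and "(LINT x|lborel. f x * laplacian \<phi> x)
      = (LINT x|lborel. f x * partial 1 (partial 1 \<phi>) x) + (LINT x|lborel. f x * partial 2 (partial 2 \<phi>) x)"
    and "integrable lborel (\<lambda>x. f x * laplacian \<phi> x)"
proof -
  have pp: "partial i (partial i \<phi>) \<in> test_functions unit_disk" for i
    by (intro test_function_partial \<phi>)
  have c: "continuous_on UNIV (\<lambda>x. f x * laplacian \<phi> x)"
    unfolding laplacian_def using f test_function_continuous[OF pp] by (intro continuous_intros)
  have z: "f x * laplacian \<phi> x = 0" if "x \<notin> unit_disk" for x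
    unfolding laplacian_def using test_function_eq_0[OF pp that] by simp
  show "(LINT x|disk_measure. f x * laplacian \<phi> x) = (LINT x|lborel. f x * laplacian \<phi> x)"
    using c z by (rule disk_integral_eq_lborel)
  show "(LINT x|lborel. f x * laplacian \<phi> x)
      = (LINT x|lborel. f x * partial 1 (partial 1 \<phi>) x) + (LINT x|lborel. f x * partial 2 (partial 2 \<phi>) x)"
    unfolding laplacian_def distrib_left
    by (intro Bochner_Integration.integral_add integrable_mult_test_function[OF f pp])
  show "integrable lborel (\<lambda>x. f x * laplacian \<phi> x)"
    unfolding laplacian_def distrib_left
    by (intro Bochner_Integration.integrable_add integrable_mult_test_function[OF f pp])
qed

lemma continuous_on_extend_by_0:
  fixes u :: "real^2 \<Rightarrow> real"
  assumes "continuous_on (cball 0 1) u" "\<And>x. x \<notin> unit_disk \<Longrightarrow> u x = 0"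
  shows "continuous_on UNIV u"
proof -
  have "continuous_on (- unit_disk) u"
    using assms(2) by (subst continuous_on_cong[OF refl, of _ u "\<lambda>_. 0"]) auto
  then have "continuous_on (cball 0 1 \<union> (- unit_disk)) u"
    using assms(1) by (intro continuous_on_closed_Un) auto
  moreover have "cball 0 1 \<union> (- unit_disk) = (UNIV :: (real^2) set)"
    by auto
  ultimately show ?thesis by simp
qed

lemma dirichlet_solution_unique:
  assumes "dirichlet_solution w u" "dirichlet_solution w u'"
  shows "u = u'"
proof
  fix x
  have c: "continuous_on UNIV u" "continuous_on UNIV u'"
    and z: "\<And>x. x \<notin> unit_disk \<Longrightarrow> u x = 0" "\<And>x. x \<notin> unit_disk \<Longrightarrow> u' x = 0"
    using assms unfolding dirichlet_solution_def by (auto intro: continuous_on_extend_by_0)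
  have "u x - u' x = 0"
  proof (rule weakly_harmonic_eq_0[where v = "\<lambda>x. u x - u' x"])
    fix \<phi> :: "real^2 \<Rightarrow> real" assume \<phi>: "\<phi> \<in> test_functions unit_disk"
    have weak: "- (LINT x|disk_measure. f x * laplacian \<phi> x) = (LINT x|disk_measure. w x * \<phi> x)"
      if "dirichlet_solution w f" for f
      using that \<phi> unfolding dirichlet_solution_def by blast
    have "(LINT x|disk_measure. u x * laplacian \<phi> x) = (LINT x|disk_measure. u' x * laplacian \<phi> x)"
      using weak[OF assms(1)] weak[OF assms(2)] by simp
    then show "(LINT x|lborel. (u x - u' x) * laplacian \<phi> x) = 0"
      using laplacian_test_function_integral[OF c(1) \<phi>] laplacian_test_function_integral[OF c(2) \<phi>]
      by (simp add: left_diff_distrib)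
  qed (use c z in \<open>auto intro!: continuous_intros\<close>)
  then show "u x = u' x" by simp
qed

lemma inv_neg_laplacian_eqI: "dirichlet_solution w u \<Longrightarrow> inv_neg_laplacian w = u"
  unfolding inv_neg_laplacian_def using dirichlet_solution_unique by blast

text \<open>The hypotheses are on a smooth \<open>U\<close> on the whole plane, although the solution is its cut-off:
  test functions are supported in the disk, so Green's identity does not see the cut.\<close>

lemma classical_dirichlet_solution:
  fixes U w :: "real^2 \<Rightarrow> real"
  assumes U: "continuous_on UNIV U" "\<And>i. has_dir_deriv U (U' i) (axis i 1)"
      "\<And>i. continuous_on UNIV (U' i)" "\<And>i. has_dir_deriv (U' i) (U'' i) (axis i 1)"
      "\<And>i. continuous_on UNIV (U'' i)"
    and boundary: "\<And>x. norm x = 1 \<Longrightarrow> U x = 0"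
    and poisson: "\<And>x. x \<in> unit_disk \<Longrightarrow> - (U'' 1 x + U'' 2 x) = w x"
  shows "dirichlet_solution w (\<lambda>x. if x \<in> unit_disk then U x else 0)"
  unfolding dirichlet_solution_def
proof (intro conjI allI impI ballI)
  show "continuous_on (cball 0 1) (\<lambda>x. if x \<in> unit_disk then U x else 0)"
  proof (subst continuous_on_cong[OF refl])
    show "continuous_on (cball 0 1) U"
      using U(1) by (rule continuous_on_subset) simp
    show "(if x \<in> unit_disk then U x else 0) = U x" if "x \<in> cball 0 1" for x
      using that boundary[of x] by auto
  qed
  fix \<phi> :: "real^2 \<Rightarrow> real" assume \<phi>: "\<phi> \<in> test_functions unit_disk"
  have parts: "(LINT x|lborel. U x * partial i (partial i \<phi>) x) = (LINT x|lborel. U'' i x * \<phi> x)" for i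
  proof -
    have "(LINT x|lborel. U x * partial i (partial i \<phi>) x) = - (LINT x|lborel. U' i x * partial i \<phi> x)"
      using integration_by_parts_test_function[OF test_function_partial[OF \<phi>, of i] _ U(2) U(1) U(3), of i]
      by (simp add: partial_def axis_in_Basis_iff)
    also have "(LINT x|lborel. U' i x * partial i \<phi> x) = - (LINT x|lborel. U'' i x * \<phi> x)"
      using integration_by_parts_test_function[OF \<phi> _ U(4) U(3) U(5), of i]
      by (simp add: partial_def axis_in_Basis_iff)
    finally show ?thesis by simp
  qed
  have "(LINT x|disk_measure. (if x \<in> unit_disk then U x else 0) * laplacian \<phi> x)
      = (LINT x|disk_measure. U x * laplacian \<phi> x)"
    by (rule disk_integral_cong) simp
  also have "\<dots> = (LINT x|lborel. U'' 1 x * \<phi> x) + (LINT x|lborel. U'' 2 x * \<phi> x)"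
    using laplacian_test_function_integral[OF U(1) \<phi>] parts by simp
  also have "\<dots> = (LINT x|lborel. (U'' 1 x + U'' 2 x) * \<phi> x)"
    using integrable_mult_test_function[OF U(5) \<phi>] by (simp add: distrib_right)
  also have "\<dots> = (LINT x|disk_measure. (U'' 1 x + U'' 2 x) * \<phi> x)"
    using U(5) by (intro disk_integral_mult_test_function[symmetric] \<phi> continuous_intros)
  also have "\<dots> = (LINT x|disk_measure. - (w x * \<phi> x))"
    by (rule disk_integral_cong) (simp add: poisson[symmetric] algebra_simps)
  finally show "- (LINT x|disk_measure. (if x \<in> unit_disk then U x else 0) * laplacian \<phi> x)
      = (LINT x|disk_measure. w x * \<phi> x)"
    by simp
qed simp

section \<open>Bessel functions as entire functions\<close>

definition bessel_entire :: "nat \<Rightarrow> real \<Rightarrow> real" where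
  "bessel_entire n s = (\<Sum>k. (-1)^k / (fact k * fact (n + k)) * s^k)"

lemma summable_bessel_entire:
  "summable (\<lambda>k. (-1)^k / (fact k * fact (n + k)) * s^k :: real)"
proof (rule summable_comparison_test')
  show "summable (\<lambda>k. inverse (fact k) * \<bar>s\<bar>^k)"
    by (rule summable_exp)
  fix k :: nat
  have "(1::real) \<le> fact (n + k)" by (rule fact_ge_1)
  then have "1 / (fact k * fact (n + k)) \<le> (1 / fact k :: real)"
    by (simp add: divide_simps)
  then have "1 / (fact k * fact (n + k)) * \<bar>s\<bar>^k \<le> 1 / fact k * \<bar>s\<bar>^k"
    by (intro mult_right_mono) auto
  then show "norm ((-1)^k / (fact k * fact (n + k)) * s^k) \<le> inverse (fact k) * \<bar>s\<bar>^k"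
    by (simp add: abs_mult power_abs inverse_eq_divide)
qed

lemma DERIV_bessel_entire:
  "(bessel_entire n has_real_derivative - bessel_entire (Suc n) s) (at s)"
proof -
  let ?c = "\<lambda>n k. (-1)^k / (fact k * fact (n + k)) :: real"
  have "(\<lambda>k. diffs (?c n) k * s^k) = (\<lambda>k. - (?c (Suc n) k * s^k))"
    by (simp add: diffs_def fun_eq_iff divide_simps)
  then have "(\<Sum>k. diffs (?c n) k * s^k) = - bessel_entire (Suc n) s"
    unfolding bessel_entire_def by (rule trans[OF arg_cong[of _ _ suminf] suminf_minus[OF summable_bessel_entire]])
  moreover have "((\<lambda>s. \<Sum>k. ?c n k * s^k) has_real_derivative (\<Sum>k. diffs (?c n) k * s^k)) (at s)"
    by (rule termdiffs_strong_converges_everywhere) (rule summable_bessel_entire)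
  ultimately show ?thesis
    unfolding bessel_entire_def[abs_def] by simp
qed

lemma DERIV_bessel_entire_chain [derivative_intros]:
  assumes "(g has_real_derivative g') (at x within S)"
  shows "((\<lambda>x. bessel_entire n (g x)) has_real_derivative - bessel_entire (Suc n) (g x) * g') (at x within S)"
  using DERIV_chain[OF DERIV_bessel_entire assms] by (simp add: o_def)

lemma continuous_on_bessel_entire [continuous_intros]:
  assumes "continuous_on S g"
  shows "continuous_on S (\<lambda>x. bessel_entire n (g x))"
proof -
  have "continuous_on UNIV (bessel_entire n)"
    using DERIV_bessel_entire by (auto intro!: DERIV_continuous_on)
  then show ?thesis
    using assms by (rule continuous_on_compose2) auto
qed

text \<open>Comparison of coefficients. This is Bessel's differential equation in disguise, since
  \<open>F\<^sub>n\<^sub>+\<^sub>1\<close> and \<open>F\<^sub>n\<^sub>+\<^sub>2\<close> are, up to sign, the first two derivatives of \<open>F\<^sub>n\<close>.\<close>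

lemma bessel_entire_recurrence:
  "bessel_entire n s = (n + 1) * bessel_entire (n + 1) s - s * bessel_entire (n + 2) s"
proof -
  let ?t = "\<lambda>n k. (-1)^k / (fact k * fact (n + k)) * s^k :: real"
  have sm: "summable (?t n)" for n by (rule summable_bessel_entire)
  have step: "?t n (Suc k) - (n + 1) * ?t (n + 1) (Suc k) = - (s * ?t (n + 2) k)" for k
    by (simp add: divide_simps) (simp add: algebra_simps)
  have "bessel_entire n s - (n + 1) * bessel_entire (n + 1) s
      = (\<Sum>k. ?t n k - (n + 1) * ?t (n + 1) k)"
    unfolding bessel_entire_def
    by (subst suminf_mult[symmetric, OF sm], rule suminf_diff[OF sm summable_mult[OF sm]])
  also have "\<dots> = (\<Sum>k. ?t n (Suc k) - (n + 1) * ?t (n + 1) (Suc k)) + (?t n 0 - (n + 1) * ?t (n + 1) 0)"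
    by (subst suminf_split_head[OF summable_diff[OF sm summable_mult[OF sm]]]) simp
  also have "\<dots> = (\<Sum>k. - (s * ?t (n + 2) k))"
    unfolding step by (simp add: divide_simps)
  also have "\<dots> = - (s * bessel_entire (n + 2) s)"
    unfolding bessel_entire_def
    by (subst suminf_mult[symmetric, OF sm], rule suminf_minus[OF summable_mult[OF sm]])
  finally show ?thesis by (simp add: algebra_simps)
qed

lemma bessel_J_eq_entire: "bessel_J n x = (x / 2)^n * bessel_entire n (x^2 / 4)"
proof -
  have "(-1)^k / (fact k * fact (n + k)) * (x / 2)^(2 * k + n)
      = (x / 2)^n * ((-1)^k / (fact k * fact (n + k)) * (x^2 / 4)^k)" for k
    
  proof -
    have "(x / 2)^(2 * k + n) = (x / 2)^n * (x^2 / 4)^k"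
      by (simp add: power_add power_mult power_divide mult.commute[of "(x^2)^k"])
    then show ?thesis by simp
  qed
  then show ?thesis
    unfolding bessel_J_def bessel_entire_def by (simp only: suminf_mult[OF summable_bessel_entire])
qed

lemma bessel_entire_at_0: "bessel_entire n 0 = 1 / fact n"
  unfolding bessel_entire_def by (subst powser_zero) simp

text \<open>Locates a sign change: \<open>s = 4\<close> corresponds to \<open>x = 4\<close>, just beyond the first zero
  \<open>j = 3.83...\<close> of \<open>J\<^sub>1\<close>. The first two terms 1 and -2 of the series are not decreasing in
  modulus, so Leibniz's bound is applied to the series without its leading 1; four terms of it,
  with sum 46/45, suffice.\<close>

lemma bessel_entire_1_at_4_neg: "bessel_entire 1 4 < 0"
proof -
  define a where "a k = (4^Suc k / (fact (Suc k) * fact (Suc (Suc k))) :: real)" for k :: nat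
  have a_Suc: "a (Suc k) = a k * (4 / (real (Suc (Suc k)) * real (Suc (Suc (Suc k)))))" for k
    unfolding a_def by (simp add: divide_simps)
  have pos: "0 \<le> a k" for k
    unfolding a_def by simp
  have dec: "a (Suc k) \<le> a k" for k
  proof -
    have "4 / (real (Suc (Suc k)) * real (Suc (Suc (Suc k)))) \<le> 1"
      by (simp add: divide_simps) (simp add: algebra_simps)
    then show ?thesis
      unfolding a_Suc by (rule mult_right_le_one_le[OF pos _, rotated]) simp
  qed
  have terms: "(-1)^Suc k / (fact (Suc k) * fact (1 + Suc k)) * 4^Suc k = - ((-1)^k * a k)" for k
    unfolding a_def by simp
  have sm: "summable (\<lambda>k. (-1)^k * a k)"
    using summable_minus[OF summable_ignore_initial_segment[OF summable_bessel_entire[of 1 4], of 1]]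
    unfolding Suc_eq_plus1[symmetric] terms by simp
  have null: "a \<longlonglongrightarrow> 0"
  proof (rule tendsto_rabs_zero_cancel)
    show "(\<lambda>k. \<bar>a k\<bar>) \<longlonglongrightarrow> 0"
      using tendsto_rabs_zero[OF summable_LIMSEQ_zero[OF sm]] by (simp add: abs_mult)
  qed
  have "(\<Sum>i<2*2. (-1)^i * a i) \<le> (\<Sum>i. (-1)^i * a i)"
    by (rule summable_Leibniz'(2)[OF null pos dec])
  moreover have "(\<Sum>i<2*2. (-1)^i * a i) = 46/45"
  proof -
    have "{..<2*2} = {0, 1, 2, 3::nat}" by auto
    then show ?thesis
      by (simp add: a_def fact_numeral)
  qed
  moreover have "bessel_entire 1 4 = 1 - (\<Sum>k. (-1)^k * a k)"

  proof -
    have "(\<Sum>k. (-1)^Suc k / (fact (Suc k) * fact (1 + Suc k)) * 4^Suc k) = bessel_entire 1 4 - 1"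
      unfolding bessel_entire_def by (subst suminf_split_head[OF summable_bessel_entire]) simp
    then show ?thesis
      unfolding terms suminf_minus[OF sm] by linarith
  qed
  ultimately show ?thesis by simp
qed

text \<open>The definition by \<open>LEAST\<close> over the reals yields a zero only if a least one exists. It does:
  positive zeros of \<open>J\<^sub>1\<close> are zeros of the continuous function \<open>f\<close>, which has one in
  \<open>[0, 4]\<close>, and 0 is not among them as \<open>f 0 = 1\<close>.\<close>

lemma bessel_zero_spec: "0 < bessel_zero" "bessel_entire 1 (bessel_zero^2 / 4) = 0"
proof -
  define f where "f x = bessel_entire 1 (x^2 / 4)" for x
  define Z where "Z = {0..4} \<inter> f -` {0}"
  have cont: "continuous_on A f" for A
    unfolding f_def by (intro continuous_intros) auto
  have f0: "f 0 = 1" and f4: "f 4 < 0"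
    using bessel_entire_1_at_4_neg by (auto simp: f_def bessel_entire_at_0)
  have "\<exists>x\<ge>0. x \<le> 4 \<and> f x = 0"
    using f0 f4 cont by (intro IVT2') auto
  then have "Z \<noteq> {}" by (auto simp: Z_def)
  moreover have "compact Z"
    unfolding Z_def compact_eq_bounded_closed
    by (intro conjI continuous_closed_preimage cont) (auto intro: bounded_subset[of "{0..4}"])
  ultimately obtain z where z: "z \<in> Z" "\<And>y. y \<in> Z \<Longrightarrow> z \<le> y"
    using compact_attains_inf by metis
  have J1: "bessel_J 1 x = 0 \<longleftrightarrow> f x = 0" if "0 < x" for x
    using that by (simp add: bessel_J_eq_entire f_def)
  have zpos: "0 < z" and fz: "f z = 0" and z4: "z \<le> 4"
    using z(1) f0 by (auto simp: Z_def order.order_iff_strict)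
  have "bessel_zero = z"
    unfolding bessel_zero_def
  proof (rule Least_equality)
    show "0 < z \<and> bessel_J 1 z = 0" using zpos fz J1 by simp
    fix y assume y: "0 < y \<and> bessel_J 1 y = 0"
    show "z \<le> y"
    proof (cases "y \<le> 4")
      case True
      then show ?thesis using y J1 by (intro z(2)) (auto simp: Z_def)
    qed (use z4 in simp)
  qed
  then show "0 < bessel_zero" "bessel_entire 1 (bessel_zero^2 / 4) = 0"
    using zpos fz by (auto simp: f_def)
qed

section \<open>The elements of \<open>V\<close> in Cartesian coordinates\<close>

text \<open>The general element of \<open>V\<close> at the point \<open>(X, Y)\<close>, where \<open>\<kappa> = j\<^sup>2 / 4\<close> and the factor
  \<open>j / 2\<close> from \<open>J\<^sub>1(jr) = (jr/2) F\<^sub>1(\<kappa> r\<^sup>2)\<close> is absorbed in \<open>b\<close> and \<open>c\<close>. The next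
  definitions are its partial derivatives; those in \<open>Y\<close> arise by exchanging \<open>X\<close> with \<open>Y\<close> and
  \<open>b\<close> with \<open>c\<close>.\<close>

definition bessel_mode :: "real \<Rightarrow> real \<Rightarrow> real \<Rightarrow> real \<Rightarrow> real \<Rightarrow> real \<Rightarrow> real" where
  "bessel_mode \<kappa> a b c X Y =
     a * bessel_entire 0 (\<kappa> * (X\<^sup>2 + Y\<^sup>2)) + bessel_entire 1 (\<kappa> * (X\<^sup>2 + Y\<^sup>2)) * (b * X + c * Y)"

definition bessel_mode_X :: "real \<Rightarrow> real \<Rightarrow> real \<Rightarrow> real \<Rightarrow> real \<Rightarrow> real \<Rightarrow> real" where
  "bessel_mode_X \<kappa> a b c X Y =
     b * bessel_entire 1 (\<kappa> * (X\<^sup>2 + Y\<^sup>2))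
     - 2 * \<kappa> * X * (a * bessel_entire 1 (\<kappa> * (X\<^sup>2 + Y\<^sup>2))
                   + bessel_entire 2 (\<kappa> * (X\<^sup>2 + Y\<^sup>2)) * (b * X + c * Y))"

definition bessel_mode_XX :: "real \<Rightarrow> real \<Rightarrow> real \<Rightarrow> real \<Rightarrow> real \<Rightarrow> real \<Rightarrow> real" where
  "bessel_mode_XX \<kappa> a b c X Y =
     - 2 * \<kappa> * (a * bessel_entire 1 (\<kappa> * (X\<^sup>2 + Y\<^sup>2))
               + bessel_entire 2 (\<kappa> * (X\<^sup>2 + Y\<^sup>2)) * (b * X + c * Y))
     - 4 * \<kappa> * b * X * bessel_entire 2 (\<kappa> * (X\<^sup>2 + Y\<^sup>2))
     + 4 * \<kappa>\<^sup>2 * X\<^sup>2 * (a * bessel_entire 2 (\<kappa> * (X\<^sup>2 + Y\<^sup>2))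
                     + bessel_entire 3 (\<kappa> * (X\<^sup>2 + Y\<^sup>2)) * (b * X + c * Y))"

definition bessel_mode_XY :: "real \<Rightarrow> real \<Rightarrow> real \<Rightarrow> real \<Rightarrow> real \<Rightarrow> real \<Rightarrow> real" where
  "bessel_mode_XY \<kappa> a b c X Y =
     4 * \<kappa>\<^sup>2 * X * Y * (a * bessel_entire 2 (\<kappa> * (X\<^sup>2 + Y\<^sup>2))
                     + bessel_entire 3 (\<kappa> * (X\<^sup>2 + Y\<^sup>2)) * (b * X + c * Y))
     - 2 * \<kappa> * (b * Y + c * X) * bessel_entire 2 (\<kappa> * (X\<^sup>2 + Y\<^sup>2))"

lemma bessel_mode_swap: "bessel_mode \<kappa> a b c X Y = bessel_mode \<kappa> a c b Y X"
  by (simp add: bessel_mode_def add.commute)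

lemma bessel_mode_XY_swap: "bessel_mode_XY \<kappa> a b c X Y = bessel_mode_XY \<kappa> a c b Y X"
  by (simp add: bessel_mode_XY_def add.commute mult.commute)

lemma bessel_entire_Suc_numeral: "bessel_entire (Suc 1) = bessel_entire 2" "bessel_entire (Suc 2) = bessel_entire 3"
  by (simp_all add: numeral_2_eq_2 numeral_3_eq_3)

lemma DERIV_bessel_mode:
  "((\<lambda>X. bessel_mode \<kappa> a b c X Y) has_real_derivative bessel_mode_X \<kappa> a b c X Y) (at X)"
  unfolding bessel_mode_def bessel_mode_X_def
  by (rule derivative_eq_intros refl | simp add: bessel_entire_Suc_numeral[simplified] algebra_simps power2_eq_square)+

lemma DERIV_bessel_mode_X:
  "((\<lambda>X. bessel_mode_X \<kappa> a b c X Y) has_real_derivative bessel_mode_XX \<kappa> a b c X Y) (at X)"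
  unfolding bessel_mode_X_def bessel_mode_XX_def
  by (rule derivative_eq_intros refl | simp add: bessel_entire_Suc_numeral[simplified] algebra_simps power2_eq_square)+

lemma DERIV_bessel_mode_X_Y:
  "((\<lambda>Y. bessel_mode_X \<kappa> a b c X Y) has_real_derivative bessel_mode_XY \<kappa> a b c X Y) (at Y)"
  unfolding bessel_mode_X_def bessel_mode_XY_def
  by (rule derivative_eq_intros refl | simp add: bessel_entire_Suc_numeral[simplified] algebra_simps power2_eq_square)+

lemma bessel_mode_eigenfunction:
  "bessel_mode_XX \<kappa> a b c X Y + bessel_mode_XX \<kappa> a c b Y X = - 4 * \<kappa> * bessel_mode \<kappa> a b c X Y"
proof -
  define s where "s = \<kappa> * (X\<^sup>2 + Y\<^sup>2)"
  have s': "\<kappa> * (Y\<^sup>2 + X\<^sup>2) = s" by (simp add: s_def add.commute)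
  have F0: "bessel_entire 0 s = bessel_entire 1 s - s * bessel_entire 2 s"
    using bessel_entire_recurrence[of 0 s] by (simp add: numeral_2_eq_2)
  have F1: "bessel_entire 1 s = 2 * bessel_entire 2 s - s * bessel_entire 3 s"
    using bessel_entire_recurrence[of 1 s] by (simp add: numeral_2_eq_2 numeral_3_eq_3)
  define f where "f = bessel_entire 2 s"
  define g where "g = bessel_entire 3 s"
  have "bessel_mode_XX \<kappa> a b c X Y + bessel_mode_XX \<kappa> a c b Y X
      = - 4 * \<kappa> * (a * ((2 * f - s * g) - s * f) + (2 * f - s * g) * (b * X + c * Y))"
    unfolding bessel_mode_XX_def s' s_def[symmetric] F1 f_def[symmetric] g_def[symmetric]
    unfolding s_def by (simp add: algebra_simps power2_eq_square)
  also have "\<dots> = - 4 * \<kappa> * bessel_mode \<kappa> a b c X Y"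
    unfolding bessel_mode_def s_def[symmetric] F0 F1 f_def g_def by simp
  finally show ?thesis .
qed

text \<open>The infinitesimal rotation of the plane acts on the coefficients \<open>(b, c)\<close> alone, again as an
  infinitesimal rotation. This lets rotating solutions be described by rotating coefficients.\<close>

lemma bessel_mode_rotation_derivative:
  "X * bessel_mode_X \<kappa> a c b Y X - Y * bessel_mode_X \<kappa> a b c X Y = bessel_mode \<kappa> 0 c (- b) X Y"
  by (simp add: bessel_mode_def bessel_mode_X_def algebra_simps power2_eq_square)

lemma continuous_on_bessel_mode [continuous_intros]:
  assumes "continuous_on S b" "continuous_on S c" "continuous_on S X" "continuous_on S Y"
  shows "continuous_on S (\<lambda>p. bessel_mode \<kappa> a (b p) (c p) (X p) (Y p))"
    and "continuous_on S (\<lambda>p. bessel_mode_X \<kappa> a (b p) (c p) (X p) (Y p))"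
    and "continuous_on S (\<lambda>p. bessel_mode_XX \<kappa> a (b p) (c p) (X p) (Y p))"
    and "continuous_on S (\<lambda>p. bessel_mode_XY \<kappa> a (b p) (c p) (X p) (Y p))"
  unfolding bessel_mode_def bessel_mode_X_def bessel_mode_XX_def bessel_mode_XY_def
  by (auto intro!: continuous_intros assms)

lemma bessel_mode_differentiable:
  "(\<lambda>x::real^2. bessel_mode \<kappa> a b c (x $ 1) (x $ 2)) differentiable (at x)"
proof -
  have nth: "((\<lambda>x::real^2. x $ i) has_derivative (\<lambda>h. h $ i)) (at x)" for i
    by (rule bounded_linear_imp_has_derivative) (rule bounded_linear_vec_nth)
  have entire: "((\<lambda>x. bessel_entire n (f x)) has_derivative (\<lambda>h. f' h * - bessel_entire (Suc n) (f x))) (at x)"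
    if "(f has_derivative f') (at x)" for n and f :: "real^2 \<Rightarrow> real" and f'
    by (rule DERIV_compose_FDERIV[OF DERIV_bessel_entire that])
  show ?thesis
    unfolding differentiable_def bessel_mode_def
    by (rule exI) (rule derivative_intros entire nth | simp)+
qed

section \<open>Stream functions of the rotating modes\<close>

lemma has_dir_deriv_coordinate_1:
  assumes "\<And>X Y. ((\<lambda>X. f X Y) has_real_derivative f' X Y) (at X)"
  shows "has_dir_deriv (\<lambda>x::real^2. f (x $ 1) (x $ 2)) (\<lambda>x. f' (x $ 1) (x $ 2)) (axis 1 1)"
  unfolding has_dir_deriv_def
proof
  fix x :: "real^2"
  show "((\<lambda>t. f ((x + t *\<^sub>R axis 1 1) $ 1) ((x + t *\<^sub>R axis 1 1) $ 2))
      has_real_derivative f' (x $ 1) (x $ 2)) (at 0)"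
    using assms[of "x $ 2" "x $ 1"] DERIV_shift[of "\<lambda>X. f X (x $ 2)" "f' (x $ 1) (x $ 2)" 0 "x $ 1"]
    by (simp add: axis_def add.commute)
qed

lemma has_dir_deriv_coordinate_2:
  assumes "\<And>X Y. ((\<lambda>Y. f X Y) has_real_derivative f' X Y) (at Y)"
  shows "has_dir_deriv (\<lambda>x::real^2. f (x $ 1) (x $ 2)) (\<lambda>x. f' (x $ 1) (x $ 2)) (axis 2 1)"
  unfolding has_dir_deriv_def
proof
  fix x :: "real^2"
  show "((\<lambda>t. f ((x + t *\<^sub>R axis 2 1) $ 1) ((x + t *\<^sub>R axis 2 1) $ 2))
      has_real_derivative f' (x $ 1) (x $ 2)) (at 0)"
    using assms[of "x $ 1" "x $ 2"] DERIV_shift[of "\<lambda>Y. f (x $ 1) Y" "f' (x $ 1) (x $ 2)" 0 "x $ 2"]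
    by (simp add: axis_def add.commute)
qed

lemma has_dir_deriv_space:
  assumes "\<And>t. has_dir_deriv (\<lambda>x. f (t, x)) (\<lambda>x. f' (t, x)) b"
  shows "has_dir_deriv f f' (0, b)"
  using assms unfolding has_dir_deriv_def by force

lemma has_dir_deriv_time:
  assumes "\<And>t x. ((\<lambda>t. f (t, x)) has_real_derivative f' (t, x)) (at t)"
  shows "has_dir_deriv f f' (1, 0)"
  unfolding has_dir_deriv_def
proof
  fix p :: "real \<times> 'a"
  show "((\<lambda>s. f (p + s *\<^sub>R (1, 0))) has_real_derivative f' p) (at 0)"
    using assms[of "snd p" "fst p"] DERIV_shift[of "\<lambda>t. f (t, snd p)" "f' p" 0 "fst p"]
    by (cases p) (simp add: add.commute)
qed

text \<open>The stream function of the vorticity \<open>bessel_mode + e\<close>. Subtracting the value of the radial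
  mode at \<open>r = 1\<close> makes it vanish on the unit circle when \<open>F\<^sub>1(\<kappa>) = 0\<close>.\<close>

definition stream_function :: "real \<Rightarrow> real \<Rightarrow> real \<Rightarrow> real \<Rightarrow> real \<Rightarrow> real^2 \<Rightarrow> real" where
  "stream_function \<kappa> a b c e x =
     (bessel_mode \<kappa> a b c (x $ 1) (x $ 2) - a * bessel_entire 0 \<kappa>) / (4 * \<kappa>)
     + e * (1 - ((x $ 1)\<^sup>2 + (x $ 2)\<^sup>2)) / 4"

definition stream_function_1 :: "real \<Rightarrow> real \<Rightarrow> real \<Rightarrow> real \<Rightarrow> real \<Rightarrow> real^2 \<Rightarrow> real" where
  "stream_function_1 \<kappa> a b c e x =
     bessel_mode_X \<kappa> a b c (x $ 1) (x $ 2) / (4 * \<kappa>) - e * x $ 1 / 2"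

definition stream_function_2 :: "real \<Rightarrow> real \<Rightarrow> real \<Rightarrow> real \<Rightarrow> real \<Rightarrow> real^2 \<Rightarrow> real" where
  "stream_function_2 \<kappa> a b c e x =
     bessel_mode_X \<kappa> a c b (x $ 2) (x $ 1) / (4 * \<kappa>) - e * x $ 2 / 2"

lemma norm_vec2: "(norm (x :: real^2))\<^sup>2 = (x $ 1)\<^sup>2 + (x $ 2)\<^sup>2"
  unfolding power2_norm_eq_inner by (simp add: inner_vec_def sum_2 power2_eq_square)

lemma has_dir_deriv_stream_function:
  "has_dir_deriv (stream_function \<kappa> a b c e) (stream_function_1 \<kappa> a b c e) (axis 1 1)"
  "has_dir_deriv (stream_function \<kappa> a b c e) (stream_function_2 \<kappa> a b c e) (axis 2 1)"
proof -
  have "((\<lambda>X. (bessel_mode \<kappa> a b c X Y - a * bessel_entire 0 \<kappa>) / (4 * \<kappa>) + e * (1 - (X\<^sup>2 + Y\<^sup>2)) / 4)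
      has_real_derivative bessel_mode_X \<kappa> a b c X Y / (4 * \<kappa>) - e * X / 2) (at X)" for b c X Y
    unfolding divide_inverse by (auto intro!: derivative_eq_intros DERIV_bessel_mode simp: mult.commute)
  note D = this
  show "has_dir_deriv (stream_function \<kappa> a b c e) (stream_function_1 \<kappa> a b c e) (axis 1 1)"
    unfolding stream_function_def[abs_def] stream_function_1_def[abs_def]
    by (rule has_dir_deriv_coordinate_1, rule D)
  show "has_dir_deriv (stream_function \<kappa> a b c e) (stream_function_2 \<kappa> a b c e) (axis 2 1)"
    unfolding stream_function_def[abs_def] stream_function_2_def[abs_def]
    by (rule has_dir_deriv_coordinate_2,
        subst (1) bessel_mode_swap, subst (1) add.commute[of "(_::real)\<^sup>2"], rule D)
qed

lemma continuous_on_stream_function: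
  "continuous_on UNIV (stream_function \<kappa> a b c e)"
  "continuous_on UNIV (stream_function_1 \<kappa> a b c e)"
  "continuous_on UNIV (stream_function_2 \<kappa> a b c e)"
  unfolding stream_function_def[abs_def] stream_function_1_def[abs_def] stream_function_2_def[abs_def] divide_inverse
  by (auto intro!: continuous_intros)

lemma inv_neg_laplacian_bessel_mode:
  assumes "0 < \<kappa>" "bessel_entire 1 \<kappa> = 0"
  shows "inv_neg_laplacian (\<lambda>x. bessel_mode \<kappa> a b c (x $ 1) (x $ 2) + e)
      = (\<lambda>x. if x \<in> unit_disk then stream_function \<kappa> a b c e x else 0)"
proof (rule inv_neg_laplacian_eqI, rule classical_dirichlet_solution)
  let ?U' = "\<lambda>i::2. if i = 1 then stream_function_1 \<kappa> a b c e else stream_function_2 \<kappa> a b c e"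
  let ?U'' = "\<lambda>(i::2) x::real^2. if i = 1 then bessel_mode_XX \<kappa> a b c (x $ 1) (x $ 2) / (4 * \<kappa>) - e / 2
      else bessel_mode_XX \<kappa> a c b (x $ 2) (x $ 1) / (4 * \<kappa>) - e / 2"
  have D: "((\<lambda>X. bessel_mode_X \<kappa> a b c X Y / (4 * \<kappa>) - e * X / 2)
      has_real_derivative bessel_mode_XX \<kappa> a b c X Y / (4 * \<kappa>) - e / 2) (at X)" for b c X Y
    unfolding divide_inverse by (auto intro!: derivative_eq_intros DERIV_bessel_mode_X)
  show "has_dir_deriv (stream_function \<kappa> a b c e) (?U' i) (axis i 1)" for i
    using has_dir_deriv_stream_function[of \<kappa> a b c e] exhaust_2[of i] by auto
  show "continuous_on UNIV (?U' i)" for i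
    using continuous_on_stream_function by simp
  show "has_dir_deriv (?U' i) (?U'' i) (axis i 1)" for i
  proof (cases "i = 1")
    case True
    show ?thesis
      unfolding True stream_function_1_def[abs_def] using has_dir_deriv_coordinate_1[OF D] by simp
  next
    case False
    then have "i = 2" using exhaust_2[of i] by auto
    then show ?thesis
      unfolding stream_function_2_def[abs_def]
      using has_dir_deriv_coordinate_2[of "\<lambda>X Y. bessel_mode_X \<kappa> a c b Y X / (4 * \<kappa>) - e * Y / 2", OF D] by simp
  qed
  show "continuous_on UNIV (?U'' i)" for i
    unfolding divide_inverse by (cases "i = 1") (auto intro!: continuous_intros)
  show "stream_function \<kappa> a b c e x = 0" if "norm x = 1" for x
  proof -
    have "(x $ 1)\<^sup>2 + (x $ 2)\<^sup>2 = 1"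
      using that norm_vec2[of x] by simp
    then show ?thesis
      using assms(2) unfolding stream_function_def bessel_mode_def by simp
  qed
  show "- (?U'' 1 x + ?U'' 2 x) = bessel_mode \<kappa> a b c (x $ 1) (x $ 2) + e" for x
  proof -
    have "?U'' 1 x + ?U'' 2 x = (bessel_mode_XX \<kappa> a b c (x $ 1) (x $ 2) + bessel_mode_XX \<kappa> a c b (x $ 2) (x $ 1)) / (4 * \<kappa>) - e"
      by (simp add: add_divide_distrib)
    also have "\<dots> = - bessel_mode \<kappa> a b c (x $ 1) (x $ 2) - e"
      unfolding bessel_mode_eigenfunction using assms(1) by simp
    finally show ?thesis by simp
  qed
qed (rule continuous_on_stream_function)

lemma stream_function_differentiable: "stream_function \<kappa> a b c e differentiable (at x)"
proof -
  have nth: "(\<lambda>x::real^2. x $ i) differentiable (at x)" for i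
    by (rule bounded_linear_imp_differentiable) (rule bounded_linear_vec_nth)
  show ?thesis
    unfolding stream_function_def[abs_def] divide_inverse
    by (intro derivative_intros bessel_mode_differentiable nth)
qed

text \<open>The cut-off at the unit circle is invisible to derivatives at points of the open disk.\<close>

lemma perp_gradient_inv_neg_laplacian_bessel_mode:
  assumes "0 < \<kappa>" "bessel_entire 1 \<kappa> = 0" and x: "x \<in> unit_disk"
  shows "perp_gradient (inv_neg_laplacian (\<lambda>x. bessel_mode \<kappa> a b c (x $ 1) (x $ 2) + e)) x
      = vector [stream_function_2 \<kappa> a b c e x, - stream_function_1 \<kappa> a b c e x]"
proof -
  let ?u = "\<lambda>x. if x \<in> unit_disk then stream_function \<kappa> a b c e x else 0"
  have D: "frechet_derivative ?u (at x) = frechet_derivative (stream_function \<kappa> a b c e) (at x)"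
  proof -
    have "(stream_function \<kappa> a b c e has_derivative frechet_derivative (stream_function \<kappa> a b c e) (at x)) (at x)"
      using stream_function_differentiable frechet_derivative_works by blast
    then have "(?u has_derivative frechet_derivative (stream_function \<kappa> a b c e) (at x)) (at x)"
      by (rule has_derivative_transform_within_open[OF _ open_ball x]) simp
    then show ?thesis by (simp add: frechet_derivative_at[symmetric])
  qed
  have "partial 1 ?u x = stream_function_1 \<kappa> a b c e x" "partial 2 ?u x = stream_function_2 \<kappa> a b c e x"
    unfolding partial_def D using has_dir_deriv_stream_function[of \<kappa> a b c e]
    by (auto intro!: frechet_derivative_eq_dir_deriv stream_function_differentiable simp: has_dir_deriv_def)
  then show ?thesis
    unfolding perp_gradient_def inv_neg_laplacian_bessel_mode[OF assms(1,2)] by simp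
qed

section \<open>The weak vorticity equation\<close>

text \<open>The mode with coefficients \<open>(b, c)\<close> turned by the angle \<open>e t / 2\<close>, carried around by the
  rigid rotation that the additive constant \<open>e\<close> generates.\<close>

definition rotating_mode :: "real \<Rightarrow> real \<Rightarrow> real \<Rightarrow> real \<Rightarrow> real \<Rightarrow> real \<Rightarrow> real^2 \<Rightarrow> real" where
  "rotating_mode \<kappa> a b c e t x =
     bessel_mode \<kappa> a (b * cos (e * t / 2) - c * sin (e * t / 2)) (c * cos (e * t / 2) + b * sin (e * t / 2))
       (x $ 1) (x $ 2) + e"

lemma DERIV_bessel_mode_coefficients:
  assumes "(b has_real_derivative b') (at t)" "(c has_real_derivative c') (at t)"
  shows "((\<lambda>t. bessel_mode \<kappa> a (b t) (c t) X Y) has_real_derivative bessel_mode \<kappa> 0 b' c' X Y) (at t)"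
  unfolding bessel_mode_def using assms by (auto intro!: derivative_eq_intros)

lemma deriv_time_slice:
  fixes \<phi> :: "real \<times> 'a::real_normed_vector \<Rightarrow> real"
  assumes "\<phi> differentiable (at (t, x))"
  shows "deriv (\<lambda>\<tau>. \<phi> (\<tau>, x)) t = frechet_derivative \<phi> (at (t, x)) (1, 0)"
proof (rule DERIV_imp_deriv)
  show "((\<lambda>\<tau>. \<phi> (\<tau>, x)) has_real_derivative frechet_derivative \<phi> (at (t, x)) (1, 0)) (at t)"
    using DERIV_frechet_line[OF assms, of "(1, 0)"]
      DERIV_shift[of "\<lambda>t. \<phi> (t, x)" "frechet_derivative \<phi> (at (t, x)) (1, 0)" 0 t]
    by (simp add: add.commute)
qed

lemma partial_space_slice:
  fixes \<phi> :: "real \<times> (real^2) \<Rightarrow> real"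
  assumes "\<phi> differentiable (at (t, x))"
  shows "partial i (\<lambda>y. \<phi> (t, y)) x = frechet_derivative \<phi> (at (t, x)) (0, axis i 1)"
  unfolding partial_def
proof (rule frechet_derivative_eq_dir_deriv)
  have \<phi>: "(\<phi> has_derivative frechet_derivative \<phi> (at (t, x))) (at (t, x))"
    using assms by (simp add: frechet_derivative_works[symmetric])
  have "((\<lambda>y. (t, y)) has_derivative (\<lambda>h. (0, h))) (at x)"
    by (auto intro!: derivative_eq_intros)
  from has_derivative_compose[OF this \<phi>]
  show "(\<lambda>y. \<phi> (t, y)) differentiable at x"
    by (rule differentiableI)
  show "((\<lambda>s. \<phi> (t, x + s *\<^sub>R axis i 1)) has_real_derivative frechet_derivative \<phi> (at (t, x)) (0, axis i 1)) (at 0)"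
    using DERIV_frechet_line[OF assms, of "(0, axis i 1)"] by simp
qed

text \<open>Fubini turns the iterated integral into one over space-time, where each of the three terms is
  integrated by parts. Extending the spatial integral from the disk to the plane is harmless
  because the derivatives of \<open>\<phi>\<close> vanish outside \<open>\<real> \<times> D\<close>.\<close>

lemma weak_conservation_law:
  fixes w f1 f2 :: "real \<times> (real^2) \<Rightarrow> real"
  assumes \<phi>: "\<phi> \<in> test_functions (UNIV \<times> unit_disk)"
    and w: "has_dir_deriv w w' (1, 0)" "continuous_on UNIV w" "continuous_on UNIV w'"
    and f1: "has_dir_deriv f1 f1' (0, axis 1 1)" "continuous_on UNIV f1" "continuous_on UNIV f1'"
    and f2: "has_dir_deriv f2 f2' (0, axis 2 1)" "continuous_on UNIV f2" "continuous_on UNIV f2'"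
    and conservation: "\<And>p. w' p + f1' p + f2' p = 0"
  shows "(LINT t|lebesgue. LINT x|disk_measure.
      w (t, x) * frechet_derivative \<phi> (at (t, x)) (1, 0)
      + f1 (t, x) * frechet_derivative \<phi> (at (t, x)) (0, axis 1 1)
      + f2 (t, x) * frechet_derivative \<phi> (at (t, x)) (0, axis 2 1)) = 0"
proof -
  have basis: "(1, 0) \<in> (Basis :: (real \<times> (real^2)) set)" "(0, axis i 1) \<in> (Basis :: (real \<times> (real^2)) set)" for i
    by (simp_all add: Basis_prod_def axis_in_Basis_iff)
  let ?D = "\<lambda>b p. frechet_derivative \<phi> (at p) b"
  have D: "?D b \<in> test_functions (UNIV \<times> unit_disk)" if "b \<in> Basis" for b
    by (rule test_function_deriv[OF \<phi> that])
  define \<Phi> where "\<Phi> p = w p * ?D (1, 0) p + f1 p * ?D (0, axis 1 1) p + f2 p * ?D (0, axis 2 1) p" for p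
  have cont: "continuous_on UNIV \<Phi>"
    unfolding \<Phi>_def
    by (intro continuous_intros w(2) f1(2) f2(2) test_function_continuous[OF D] basis)
  have int: "integrable lborel \<Phi>"
    unfolding \<Phi>_def
    by (intro Bochner_Integration.integrable_add integrable_mult_test_function[OF _ D] w(2) f1(2) f2(2) basis)
  have zero: "\<Phi> (t, x) = 0" if "x \<notin> unit_disk" for t x
    unfolding \<Phi>_def using that test_function_eq_0[OF D, of _ "(t, x)"] basis by simp
  have inner: "(LINT x|disk_measure. \<Phi> (t, x)) = (LINT x|lborel. \<Phi> (t, x))" for t
    by (rule disk_integral_eq_lborel)
       (auto intro!: continuous_on_compose2[OF cont] continuous_intros zero)
  have "(LINT t|lebesgue. LINT x|disk_measure. \<Phi> (t, x)) = (LINT t|lebesgue. LINT x|lborel. \<Phi> (t, x))"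
    unfolding inner ..
  also have "\<dots> = (LINT t|lborel. LINT x|lborel. \<Phi> (t, x))"
  proof (rule integral_completion)
    have "\<Phi> \<in> borel_measurable (lborel \<Otimes>\<^sub>M lborel)"
      unfolding lborel_prod using cont by (simp add: borel_measurable_continuous_onI)
    then show "(\<lambda>t. LINT x|lborel. \<Phi> (t, x)) \<in> borel_measurable lborel"
      by (intro lborel.borel_measurable_lebesgue_integral) simp
  qed
  also have "\<dots> = (LINT p|lborel. \<Phi> p)"
    using lborel_pair.integral_fst'[of \<Phi>] int unfolding lborel_prod by simp
  also have "\<dots> = (LINT p|lborel. w p * ?D (1, 0) p) + (LINT p|lborel. f1 p * ?D (0, axis 1 1) p)
      + (LINT p|lborel. f2 p * ?D (0, axis 2 1) p)"
    unfolding \<Phi>_def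
    by (simp add: integrable_mult_test_function[OF _ D] w(2) f1(2) f2(2) basis)
  also have "\<dots> = - ((LINT p|lborel. w' p * \<phi> p) + (LINT p|lborel. f1' p * \<phi> p) + (LINT p|lborel. f2' p * \<phi> p))"
    using integration_by_parts_test_function[OF \<phi> basis(1) w]
      integration_by_parts_test_function[OF \<phi> basis(2) f1]
      integration_by_parts_test_function[OF \<phi> basis(2) f2] by simp
  also have "(LINT p|lborel. w' p * \<phi> p) + (LINT p|lborel. f1' p * \<phi> p) + (LINT p|lborel. f2' p * \<phi> p)
      = (LINT p|lborel. w' p * \<phi> p + f1' p * \<phi> p + f2' p * \<phi> p)"
    by (simp add: integrable_mult_test_function[OF _ \<phi>] w(3) f1(3) f2(3))
  also have "\<dots> = 0"
    unfolding distrib_right[symmetric] conservation by simp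
  finally show ?thesis unfolding \<Phi>_def by simp
qed

text \<open>In \<open>p1 v1 + p2 v2\<close>, the gradient of the mode times the velocity, the part of the velocity
  parallel to the level lines of the mode cancels. What is left is the action of the rigid rotation
  with angular speed \<open>e / 2\<close>, which \<open>w'\<close> compensates.\<close>

lemma weak_vorticity_equation_rotating_mode:
  assumes \<kappa>: "0 < \<kappa>" "bessel_entire 1 \<kappa> = 0"
  shows "weak_vorticity_equation (rotating_mode \<kappa> a b c e)"
  unfolding weak_vorticity_equation_def
proof
  fix \<phi> :: "real \<times> (real^2) \<Rightarrow> real"
  assume \<phi>: "\<phi> \<in> test_functions (UNIV \<times> unit_disk)"
  define B where "B t = b * cos (e * t / 2) - c * sin (e * t / 2)" for t
  define C where "C t = c * cos (e * t / 2) + b * sin (e * t / 2)" for t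
  define w where "w p = bessel_mode \<kappa> a (B (fst p)) (C (fst p)) (snd p $ 1) (snd p $ 2) + e" for p :: "real \<times> (real^2)"
  define p1 where "p1 p = bessel_mode_X \<kappa> a (B (fst p)) (C (fst p)) (snd p $ 1) (snd p $ 2)" for p :: "real \<times> (real^2)"
  define p2 where "p2 p = bessel_mode_X \<kappa> a (C (fst p)) (B (fst p)) (snd p $ 2) (snd p $ 1)" for p :: "real \<times> (real^2)"
  define p12 where "p12 p = bessel_mode_XY \<kappa> a (B (fst p)) (C (fst p)) (snd p $ 1) (snd p $ 2)" for p :: "real \<times> (real^2)"
  define v1 where "v1 p = p2 p / (4 * \<kappa>) - e * snd p $ 2 / 2" for p :: "real \<times> (real^2)"
  define v2 where "v2 p = - (p1 p / (4 * \<kappa>) - e * snd p $ 1 / 2)" for p :: "real \<times> (real^2)"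
  define w' where "w' p = bessel_mode \<kappa> 0 (- (e / 2) * C (fst p)) (e / 2 * B (fst p)) (snd p $ 1) (snd p $ 2)" for p :: "real \<times> (real^2)"
  have BC: "(B has_real_derivative - (e / 2) * C t) (at t)" "(C has_real_derivative e / 2 * B t) (at t)" for t
    unfolding B_def C_def by (auto intro!: derivative_eq_intros simp: algebra_simps)
  have cBC: "continuous_on UNIV (\<lambda>p :: real \<times> (real^2). B (fst p))"
    "continuous_on UNIV (\<lambda>p :: real \<times> (real^2). C (fst p))"
    unfolding B_def C_def divide_inverse by (auto intro!: continuous_intros)
  have cont: "continuous_on UNIV w" "continuous_on UNIV w'" "continuous_on UNIV p1" "continuous_on UNIV p2"
    "continuous_on UNIV p12" "continuous_on UNIV v1" "continuous_on UNIV v2"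
    unfolding w_def w'_def p1_def p2_def p12_def v1_def v2_def divide_inverse
    by (auto intro!: continuous_intros cBC)
  have DY: "((\<lambda>Y. bessel_mode \<kappa> a b c X Y) has_real_derivative bessel_mode_X \<kappa> a c b Y X) (at Y)" for b c X Y
    by (subst bessel_mode_swap) (rule DERIV_bessel_mode)
  have dw: "has_dir_deriv w p1 (0, axis 1 1)" "has_dir_deriv w p2 (0, axis 2 1)"
    unfolding w_def p1_def p2_def
    by (rule has_dir_deriv_space, simp, rule has_dir_deriv_coordinate_1 has_dir_deriv_coordinate_2,
        auto intro!: derivative_eq_intros DERIV_bessel_mode DY)+
  have dv: "has_dir_deriv v1 (\<lambda>p. p12 p / (4 * \<kappa>)) (0, axis 1 1)"
    "has_dir_deriv v2 (\<lambda>p. - (p12 p / (4 * \<kappa>))) (0, axis 2 1)"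
  proof -
    have DX: "((\<lambda>X. bessel_mode_X \<kappa> a c b Y X) has_real_derivative bessel_mode_XY \<kappa> a b c X Y) (at X)" for b c X Y
      by (subst bessel_mode_XY_swap) (rule DERIV_bessel_mode_X_Y)
    show "has_dir_deriv v1 (\<lambda>p. p12 p / (4 * \<kappa>)) (0, axis 1 1)"
      unfolding v1_def p2_def p12_def divide_inverse
      by (rule has_dir_deriv_space, simp, rule has_dir_deriv_coordinate_1)
         (auto intro!: derivative_eq_intros DX)
    show "has_dir_deriv v2 (\<lambda>p. - (p12 p / (4 * \<kappa>))) (0, axis 2 1)"
      unfolding v2_def p1_def p12_def divide_inverse
      by (rule has_dir_deriv_space, simp, rule has_dir_deriv_coordinate_2)
         (auto intro!: derivative_eq_intros DERIV_bessel_mode_X_Y)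
  qed
  have "(LINT t|lebesgue. LINT x|disk_measure.
      w (t, x) * frechet_derivative \<phi> (at (t, x)) (1, 0)
      + (w (t, x) * v1 (t, x)) * frechet_derivative \<phi> (at (t, x)) (0, axis 1 1)
      + (w (t, x) * v2 (t, x)) * frechet_derivative \<phi> (at (t, x)) (0, axis 2 1)) = 0"
  proof (rule weak_conservation_law[OF \<phi>])
    show "has_dir_deriv w w' (1, 0)"
    proof (rule has_dir_deriv_time)
      show "((\<lambda>t. w (t, x)) has_real_derivative w' (t, x)) (at t)" for t x
        unfolding w_def w'_def by (auto intro!: derivative_eq_intros DERIV_bessel_mode_coefficients BC)
    qed
    show "has_dir_deriv (\<lambda>p. w p * v1 p) (\<lambda>p. w p * (p12 p / (4 * \<kappa>)) + p1 p * v1 p) (0, axis 1 1)"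
      by (rule has_dir_deriv_mult[OF dw(1) dv(1)])
    show "has_dir_deriv (\<lambda>p. w p * v2 p) (\<lambda>p. w p * - (p12 p / (4 * \<kappa>)) + p2 p * v2 p) (0, axis 2 1)"
      by (rule has_dir_deriv_mult[OF dw(2) dv(2)])
    show "w' p + (w p * (p12 p / (4 * \<kappa>)) + p1 p * v1 p) + (w p * - (p12 p / (4 * \<kappa>)) + p2 p * v2 p) = 0" for p
    proof -
      have "p1 p * v1 p + p2 p * v2 p = e / 2 * (snd p $ 1 * p2 p - snd p $ 2 * p1 p)"
        unfolding v1_def v2_def by (simp add: field_simps)
      also have "\<dots> = e / 2 * bessel_mode \<kappa> 0 (C (fst p)) (- B (fst p)) (snd p $ 1) (snd p $ 2)"
        unfolding p1_def p2_def bessel_mode_rotation_derivative ..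
      also have "\<dots> = - w' p"
        unfolding w'_def bessel_mode_def by (simp add: algebra_simps)
      finally show ?thesis by simp
    qed
  qed (use cont \<kappa> in \<open>auto intro!: continuous_intros\<close>)
  also have "(\<lambda>t. LINT x|disk_measure.
      w (t, x) * frechet_derivative \<phi> (at (t, x)) (1, 0)
      + (w (t, x) * v1 (t, x)) * frechet_derivative \<phi> (at (t, x)) (0, axis 1 1)
      + (w (t, x) * v2 (t, x)) * frechet_derivative \<phi> (at (t, x)) (0, axis 2 1))
    = (\<lambda>t. LINT x|disk_measure.
      rotating_mode \<kappa> a b c e t x * (deriv (\<lambda>\<tau>. \<phi> (\<tau>, x)) t +
        perp_gradient (inv_neg_laplacian (rotating_mode \<kappa> a b c e t)) x \<bullet> gradient (\<lambda>y. \<phi> (t, y)) x))"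
  proof (intro ext disk_integral_cong)
    fix t and x :: "real^2" assume x: "x \<in> unit_disk"
    have \<phi>d: "\<phi> differentiable (at (t, x))" by (rule test_function_differentiable[OF \<phi>])
    have rm: "rotating_mode \<kappa> a b c e t = (\<lambda>x. bessel_mode \<kappa> a (B t) (C t) (x $ 1) (x $ 2) + e)"
      by (simp add: fun_eq_iff rotating_mode_def B_def C_def)
    have "perp_gradient (inv_neg_laplacian (rotating_mode \<kappa> a b c e t)) x = vector [v1 (t, x), v2 (t, x)]"
      unfolding rm perp_gradient_inv_neg_laplacian_bessel_mode[OF \<kappa> x]
      by (simp add: v1_def v2_def p1_def p2_def stream_function_1_def stream_function_2_def)
    then show "w (t, x) * frechet_derivative \<phi> (at (t, x)) (1, 0)
      + (w (t, x) * v1 (t, x)) * frechet_derivative \<phi> (at (t, x)) (0, axis 1 1)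
      + (w (t, x) * v2 (t, x)) * frechet_derivative \<phi> (at (t, x)) (0, axis 2 1)
      = rotating_mode \<kappa> a b c e t x * (deriv (\<lambda>\<tau>. \<phi> (\<tau>, x)) t +
        perp_gradient (inv_neg_laplacian (rotating_mode \<kappa> a b c e t)) x \<bullet> gradient (\<lambda>y. \<phi> (t, y)) x)"
      unfolding deriv_time_slice[OF \<phi>d] gradient_def partial_space_slice[OF \<phi>d]
      by (simp add: rm w_def inner_vec_def sum_2 algebra_simps)
  qed
  finally show "(LINT t|lebesgue. LINT x|disk_measure.
      rotating_mode \<kappa> a b c e t x * (deriv (\<lambda>\<tau>. \<phi> (\<tau>, x)) t +
        perp_gradient (inv_neg_laplacian (rotating_mode \<kappa> a b c e t)) x \<bullet> gradient (\<lambda>y. \<phi> (t, y)) x)) = 0" .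
qed

section \<open>Invariance under rotations\<close>

definition plane_rotation :: "real \<Rightarrow> real^2 \<Rightarrow> real^2" where
  "plane_rotation s x = vector [x $ 1 * cos s + x $ 2 * sin s, x $ 2 * cos s - x $ 1 * sin s]"

lemma plane_rotation_nth [simp]:
  "plane_rotation s x $ 1 = x $ 1 * cos s + x $ 2 * sin s"
  "plane_rotation s x $ 2 = x $ 2 * cos s - x $ 1 * sin s"
  by (simp_all add: plane_rotation_def)

lemma plane_rotation_square:
  "(x $ 1 * cos s + x $ 2 * sin s)\<^sup>2 + (x $ 2 * cos s - x $ 1 * sin s)\<^sup>2 = (x $ 1)\<^sup>2 + (x $ 2)\<^sup>2"
  for x :: "real^2"
proof -
  have "(X * C + Y * S)\<^sup>2 + (Y * C - X * S)\<^sup>2 = (X\<^sup>2 + Y\<^sup>2) * (S\<^sup>2 + C\<^sup>2)" for X Y C S :: real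
    by algebra
  then show ?thesis by simp
qed

lemma norm_plane_rotation [simp]: "norm (plane_rotation s x) = norm x"
proof -
  have "(norm (plane_rotation s x))\<^sup>2 = (norm x)\<^sup>2"
    unfolding norm_vec2 using plane_rotation_square[of x s] by simp
  then show ?thesis by simp
qed

lemma plane_rotation_in_disk: "plane_rotation s x \<in> unit_disk \<longleftrightarrow> x \<in> unit_disk"
  by simp

lemma plane_rotation_inverse:
  "plane_rotation s (plane_rotation (- s) x) = x" "plane_rotation (- s) (plane_rotation s x) = x"
proof -
  have *: "x * cos s * cos s + x * sin s * sin s = x" for x s :: real
    unfolding mult.assoc distrib_left[symmetric] sin_cos_squared_add3 by simp
  have "plane_rotation s (plane_rotation (- s) x) = x" for s
    using *[of "x $ 1" s] *[of "x $ 2" s] by (simp add: vec_eq_iff forall_2 algebra_simps)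
  from this[of s] this[of "- s"] show
    "plane_rotation s (plane_rotation (- s) x) = x" "plane_rotation (- s) (plane_rotation s x) = x"
    by simp_all
qed

lemma orthogonal_plane_rotation: "orthogonal_transformation (plane_rotation s)"
  unfolding orthogonal_transformation
  by (auto intro!: linearI simp: vec_eq_iff forall_2 algebra_simps)

lemma plane_rotation_vimage: "plane_rotation s -` S = plane_rotation (- s) ` S"
  using plane_rotation_inverse by (auto simp: image_iff) metis

lemma continuous_on_plane_rotation: "continuous_on S (plane_rotation s)"
  using orthogonal_transformation_linear[OF orthogonal_plane_rotation]
  by (rule linear_continuous_on[OF linear_conv_bounded_linear[THEN iffD1]])

text \<open>Boxes determine Lebesgue measure, and orthogonal maps preserve their volume.\<close>

lemma distr_lborel_plane_rotation: "distr lborel borel (plane_rotation s) = (lborel :: (real^2) measure)"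
proof (rule lborel_eqI[symmetric])
  fix l u :: "real^2" assume le: "\<And>b. b \<in> Basis \<Longrightarrow> l \<bullet> b \<le> u \<bullet> b"
  have m: "plane_rotation s \<in> borel \<rightarrow>\<^sub>M borel"
    by (rule borel_measurable_continuous_onI[OF continuous_on_plane_rotation])
  have "emeasure (distr lborel borel (plane_rotation s)) (box l u) = emeasure lborel (plane_rotation s -` box l u)"
    using m by (subst emeasure_distr) auto
  also have "\<dots> = emeasure lebesgue (plane_rotation (- s) ` box l u)"
    using measurable_sets[OF m, of "box l u"] unfolding plane_rotation_vimage by simp
  also have "\<dots> = measure lebesgue (plane_rotation (- s) ` box l u)"
    using measurable_orthogonal_image[OF orthogonal_plane_rotation lmeasurable_box]
    by (simp add: emeasure_eq_measure2)
  also have "\<dots> = measure lebesgue (box l u)"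
    using measure_orthogonal_image[OF orthogonal_plane_rotation lmeasurable_box] by simp
  also have "\<dots> = (\<Prod>b\<in>Basis. (u - l) \<bullet> b)"
    using le by (simp add: measure_lborel_box_eq inner_diff_left)
  finally show "emeasure (distr lborel borel (plane_rotation s)) (box l u) = (\<Prod>b\<in>Basis. (u - l) \<bullet> b)" .
qed simp

lemma integral_plane_rotation:
  assumes "continuous_on UNIV (f :: real^2 \<Rightarrow> real)"
  shows "(LINT x|lborel. f (plane_rotation s x)) = (LINT x|lborel. f x)"
proof -
  have "(LINT x|lborel. f x) = (LINT x|distr lborel borel (plane_rotation s). f x)"
    unfolding distr_lborel_plane_rotation ..
  also have "\<dots> = (LINT x|lborel. f (plane_rotation s x))"
    using assms continuous_on_plane_rotation
    by (subst integral_distr) (auto intro: borel_measurable_continuous_onI)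
  finally show ?thesis ..
qed

lemma bessel_mode_plane_rotation:
  "bessel_mode \<kappa> a (b * cos s - c * sin s) (c * cos s + b * sin s) (x $ 1) (x $ 2)
    = bessel_mode \<kappa> a b c (plane_rotation s x $ 1) (plane_rotation s x $ 2)"
  unfolding bessel_mode_def plane_rotation_nth plane_rotation_square by (simp add: algebra_simps)

lemma rotating_mode_eq_plane_rotation:
  "rotating_mode \<kappa> a b c e t x = rotating_mode \<kappa> a b c e 0 (plane_rotation (e * t / 2) x)"
  unfolding rotating_mode_def bessel_mode_plane_rotation by simp

lemma continuous_on_rotating_mode:
  "continuous_on S (rotating_mode \<kappa> a b c e t)"
  unfolding rotating_mode_def[abs_def] by (auto intro!: continuous_intros)

text \<open>The stream function rotates together with the vorticity, so the energy density does too.\<close>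

lemma energy_rotating_mode:
  assumes "0 < \<kappa>" "bessel_entire 1 \<kappa> = 0"
  shows "energy (rotating_mode \<kappa> a b c e t) = energy (rotating_mode \<kappa> a b c e 0)"
proof -
  define B where "B t = b * cos (e * t / 2) - c * sin (e * t / 2)" for t
  define C where "C t = c * cos (e * t / 2) + b * sin (e * t / 2)" for t
  define u where "u t x = (if x \<in> unit_disk then stream_function \<kappa> a (B t) (C t) e x else 0)" for t x
  have rm: "rotating_mode \<kappa> a b c e t = (\<lambda>x. bessel_mode \<kappa> a (B t) (C t) (x $ 1) (x $ 2) + e)" for t
    by (simp add: fun_eq_iff rotating_mode_def B_def C_def)
  have G: "inv_neg_laplacian (rotating_mode \<kappa> a b c e t) = u t" for t
    unfolding rm u_def by (rule inv_neg_laplacian_bessel_mode[OF assms])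
  have cu: "continuous_on UNIV (u t)" for t
  proof (rule continuous_on_extend_by_0)
    have "stream_function \<kappa> a (B t) (C t) e x = 0" if "norm x = 1" for x
      using that norm_vec2[of x] assms(2) by (simp add: stream_function_def bessel_mode_def)
    then have "u t x = stream_function \<kappa> a (B t) (C t) e x" if "x \<in> cball 0 1" for x
      using that by (auto simp: u_def)
    then show "continuous_on (cball 0 1) (u t)"
      using continuous_on_subset[OF continuous_on_stream_function(1)]
      by (subst continuous_on_cong[OF refl]) auto
  qed (simp add: u_def)
  have int: "(LINT x|disk_measure. rotating_mode \<kappa> a b c e t x * u t x)
      = (LINT x|lborel. rotating_mode \<kappa> a b c e t x * u t x)" for t
    by (intro disk_integral_eq_lborel continuous_intros continuous_on_rotating_mode cu) (simp add: u_def)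
  have u_rot: "u t x = u 0 (plane_rotation (e * t / 2) x)" for x
    unfolding u_def stream_function_def B_def C_def bessel_mode_plane_rotation
    using plane_rotation_square[of x "e * t / 2"] by simp
  have "(LINT x|lborel. rotating_mode \<kappa> a b c e t x * u t x)
      = (LINT x|lborel. rotating_mode \<kappa> a b c e 0 x * u 0 x)"
    unfolding rotating_mode_eq_plane_rotation[of _ _ _ _ _ t] u_rot
    by (rule integral_plane_rotation[where f = "\<lambda>x. rotating_mode \<kappa> a b c e 0 x * u 0 x"])
       (intro continuous_intros continuous_on_rotating_mode cu)
  then show ?thesis
    unfolding energy_def G int by simp
qed

lemma distribution_rotating_mode:
  "measure disk_measure {x \<in> unit_disk. rotating_mode \<kappa> a b c e t x > s}
    = measure disk_measure {x \<in> unit_disk. rotating_mode \<kappa> a b c e 0 x > s}"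
proof -
  let ?S = "\<lambda>t. {x \<in> unit_disk. rotating_mode \<kappa> a b c e t x > s}"
  have "open (?S 0)"
    using continuous_open_preimage[OF continuous_on_rotating_mode open_ball, of "{s<..}" 0 1 \<kappa> a b c e 0]
    by (simp add: Int_def vimage_def)
  then have S0: "?S 0 \<in> lmeasurable"
    by (intro lmeasurable_open bounded_subset[OF bounded_ball[of 0 1]]) auto
  have St: "?S t = plane_rotation (- (e * t / 2)) ` ?S 0"
    unfolding plane_rotation_vimage[symmetric]
    by (auto simp: rotating_mode_eq_plane_rotation[of _ _ _ _ _ t])
  have "measure lebesgue (?S t) = measure lebesgue (?S 0)"
    unfolding St by (rule measure_orthogonal_image[OF orthogonal_plane_rotation S0])
  then show ?thesis
    by (subst (1 2) measure_restrict_space) auto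
qed

section \<open>Lebesgue norms on the disk\<close>

lemma finite_disk_measure: "finite_measure disk_measure"
  by (rule finite_measure_lebesgue_on) (simp add: lmeasurable_ball)

lemma disk_measurable_continuous:
  assumes "continuous_on UNIV F" "\<And>x. x \<in> unit_disk \<Longrightarrow> f x = F x"
  shows "f \<in> borel_measurable disk_measure"
proof -
  have "F \<in> borel_measurable disk_measure"
    using continuous_on_subset[OF assms(1)]
    by (intro continuous_imp_measurable_on_sets_lebesgue) auto
  then show ?thesis
    using assms(2) by (subst measurable_cong[of _ f F]) auto
qed

lemma Lp_bounded:
  assumes f: "f \<in> borel_measurable disk_measure" and M: "\<And>x. x \<in> unit_disk \<Longrightarrow> \<bar>f x\<bar> \<le> M" and s: "0 < s"
  shows "f \<in> Lp_space s" and "Lp_norm s f \<le> M * measure lebesgue (unit_disk :: (real^2) set) powr (1 / s)"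
proof -
  interpret finite_measure disk_measure by (rule finite_disk_measure)
  have "(0 :: real^2) \<in> unit_disk" by simp
  then have M0: "0 \<le> M" using M abs_ge_zero order_trans by blast
  have bd: "\<bar>f x\<bar> powr s \<le> M powr s" if "x \<in> unit_disk" for x
    using M[OF that] s by (intro powr_mono2) auto
  have int: "integrable disk_measure (\<lambda>x. \<bar>f x\<bar> powr s)"
    using f bd by (intro integrable_const_bound[of _ "M powr s"]) auto
  then show "f \<in> Lp_space s"
    using f by (simp add: Lp_space_def)
  have "(LINT x|disk_measure. \<bar>f x\<bar> powr s) \<le> (LINT x|disk_measure. M powr s)"
    using bd by (intro integral_mono int) auto
  also have "\<dots> = M powr s * measure lebesgue (unit_disk :: (real^2) set)"
    by (simp add: measure_restrict_space mult.commute)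
  finally have "Lp_norm s f \<le> (M powr s * measure lebesgue (unit_disk :: (real^2) set)) powr (1 / s)"
    unfolding Lp_norm_def using s by (intro powr_mono2) (auto intro: integral_nonneg)
  also have "\<dots> = M * measure lebesgue (unit_disk :: (real^2) set) powr (1 / s)"
    using M0 s by (simp add: powr_mult powr_powr)
  finally show "Lp_norm s f \<le> M * measure lebesgue (unit_disk :: (real^2) set) powr (1 / s)" .
qed

lemma Lp_norm_nonneg: "0 \<le> Lp_norm s f"
  by (simp add: Lp_norm_def)

lemma bounded_on_disk:
  assumes "continuous_on UNIV (f :: real^2 \<Rightarrow> real)"
  obtains M where "0 \<le> M" "\<And>x. x \<in> unit_disk \<Longrightarrow> \<bar>f x\<bar> \<le> M"
proof -
  have "compact (f ` cball 0 1)"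
    by (intro compact_continuous_image continuous_on_subset[OF assms]) auto
  then obtain M where M: "\<forall>y\<in>f ` cball 0 1. norm y \<le> M"
    using compact_imp_bounded bounded_iff by metis
  show ?thesis
  proof (rule that[of "\<bar>M\<bar>"])
    show "\<bar>f x\<bar> \<le> \<bar>M\<bar>" if "x \<in> unit_disk" for x
    proof -
      have "f x \<in> f ` cball 0 1" using that by (intro imageI) simp
      with M have "norm (f x) \<le> M" by blast
      then show ?thesis by simp
    qed
  qed simp
qed

text \<open>The limit \<open>g\<close> is compared with a continuous \<open>G\<close> on the disk only, since members of
  \<open>V\<close> are arbitrary outside the disk.\<close>

lemma Lp_converges_add_null_constant:
  assumes G: "continuous_on UNIV G" "\<And>x. x \<in> unit_disk \<Longrightarrow> g x = G x"
    and f: "\<And>n x. x \<in> unit_disk \<Longrightarrow> f n x = G x + h n"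
    and h: "h \<longlonglongrightarrow> 0" and s: "0 < s"
  shows "Lp_converges s f g"
  unfolding Lp_converges_def
proof (intro conjI allI)
  have mf: "f n \<in> borel_measurable disk_measure" for n
    using G(1) f by (intro disk_measurable_continuous[of "\<lambda>x. G x + h n"] continuous_intros) auto
  have mg: "g \<in> borel_measurable disk_measure"
    using G by (rule disk_measurable_continuous)
  obtain M where M: "0 \<le> M" "\<And>x. x \<in> unit_disk \<Longrightarrow> \<bar>G x\<bar> \<le> M"
    using bounded_on_disk[OF G(1)] by metis
  show "f n \<in> Lp_space s" for n
  proof (rule Lp_bounded(1)[OF mf _ s])
    show "\<bar>f n x\<bar> \<le> M + \<bar>h n\<bar>" if "x \<in> unit_disk" for x
      using M(2)[OF that] f[OF that, of n] by linarith
  qed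
  show "g \<in> Lp_space s"
    using M(2) G(2) by (intro Lp_bounded(1)[OF mg _ s, of M]) simp
  let ?c = "measure lebesgue (unit_disk :: (real^2) set) powr (1 / s)"
  have le: "Lp_norm s (\<lambda>x. f n x - g x) \<le> \<bar>h n\<bar> * ?c" for n
    using G(2) f by (intro Lp_bounded(2)[OF borel_measurable_diff[OF mf mg] _ s]) simp
  have "(\<lambda>n. \<bar>h n\<bar> * ?c) \<longlonglongrightarrow> 0"
    using tendsto_mult_right[OF tendsto_rabs_zero[OF h], of ?c] by simp
  then show "(\<lambda>n. Lp_norm s (\<lambda>x. f n x - g x)) \<longlonglongrightarrow> 0"
    by (rule tendsto_sandwich[OF _ _ tendsto_const, rotated 2])
       (intro always_eventually allI Lp_norm_nonneg le)+
qed

lemma bessel_mode_bound: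
  obtains K where "0 \<le> K"
    "\<And>a b c x. x \<in> unit_disk \<Longrightarrow> \<bar>bessel_mode \<kappa> a b c (x $ 1) (x $ 2)\<bar> \<le> K * (\<bar>a\<bar> + \<bar>b\<bar> + \<bar>c\<bar>)"
proof -
  have "\<exists>M\<ge>0. \<forall>x\<in>unit_disk. \<bar>bessel_entire n (\<kappa> * ((x $ 1)\<^sup>2 + (x $ 2)\<^sup>2))\<bar> \<le> M" for n
    by (rule bounded_on_disk[of "\<lambda>x. bessel_entire n (\<kappa> * ((x $ 1)\<^sup>2 + (x $ 2)\<^sup>2))"])
       (auto intro!: continuous_intros)
  then obtain M where M: "\<And>n. 0 \<le> M n"
    "\<And>n x. x \<in> unit_disk \<Longrightarrow> \<bar>bessel_entire n (\<kappa> * ((x $ 1)\<^sup>2 + (x $ 2)\<^sup>2))\<bar> \<le> M n"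
    by metis
  show ?thesis
  proof (rule that[of "M 0 + M 1"])
    show "0 \<le> M 0 + M 1" using M(1) by (simp add: add_nonneg_nonneg)
    fix a b c and x :: "real^2" assume x: "x \<in> unit_disk"
    let ?s = "\<kappa> * ((x $ 1)\<^sup>2 + (x $ 2)\<^sup>2)"
    have x1: "\<bar>x $ i\<bar> \<le> 1" for i
      using x component_le_norm_cart[of x i] by simp
    have "\<bar>b * x $ 1 + c * x $ 2\<bar> \<le> \<bar>b\<bar> * \<bar>x $ 1\<bar> + \<bar>c\<bar> * \<bar>x $ 2\<bar>"
      using abs_triangle_ineq[of "b * x $ 1" "c * x $ 2"] by (simp add: abs_mult)
    also have "\<dots> \<le> \<bar>b\<bar> * 1 + \<bar>c\<bar> * 1"
      using x1 by (intro add_mono mult_left_mono) auto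
    finally have L: "\<bar>b * x $ 1 + c * x $ 2\<bar> \<le> \<bar>b\<bar> + \<bar>c\<bar>" by simp
    have "\<bar>bessel_mode \<kappa> a b c (x $ 1) (x $ 2)\<bar>
        \<le> \<bar>a\<bar> * \<bar>bessel_entire 0 ?s\<bar> + \<bar>bessel_entire 1 ?s\<bar> * \<bar>b * x $ 1 + c * x $ 2\<bar>"
      unfolding bessel_mode_def abs_mult[symmetric] by (rule abs_triangle_ineq)
    also have "\<dots> \<le> \<bar>a\<bar> * M 0 + M 1 * (\<bar>b\<bar> + \<bar>c\<bar>)"
      using M x L by (intro add_mono mult_mono) auto
    also have "\<dots> \<le> (M 0 + M 1) * (\<bar>a\<bar> + \<bar>b\<bar> + \<bar>c\<bar>)"
      using M(1) by (simp add: algebra_simps add_nonneg_nonneg)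
    finally show "\<bar>bessel_mode \<kappa> a b c (x $ 1) (x $ 2)\<bar> \<le> (M 0 + M 1) * (\<bar>a\<bar> + \<bar>b\<bar> + \<bar>c\<bar>)" .
  qed
qed

section \<open>Rotating solutions and their orbits\<close>

lemma yudovich_solution_rotating_mode:
  assumes "0 < \<kappa>" "bessel_entire 1 \<kappa> = 0"
  shows "yudovich_solution (rotating_mode \<kappa> a b c e 0) (rotating_mode \<kappa> a b c e)"
proof -
  define B where "B t = b * cos (e * t / 2) - c * sin (e * t / 2)" for t
  define C where "C t = c * cos (e * t / 2) + b * sin (e * t / 2)" for t
  have rm: "rotating_mode \<kappa> a b c e t x = bessel_mode \<kappa> a (B t) (C t) (x $ 1) (x $ 2) + e" for t x
    by (simp add: rotating_mode_def B_def C_def)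
  obtain K where K: "0 \<le> K"
    "\<And>a b c x. x \<in> unit_disk \<Longrightarrow> \<bar>bessel_mode \<kappa> a b c (x $ 1) (x $ 2)\<bar> \<le> K * (\<bar>a\<bar> + \<bar>b\<bar> + \<bar>c\<bar>)"
    using bessel_mode_bound[of \<kappa>] by metis
  define M where "M = K * (\<bar>a\<bar> + (\<bar>b\<bar> + \<bar>c\<bar>) + (\<bar>c\<bar> + \<bar>b\<bar>)) + \<bar>e\<bar>"
  have bound: "\<bar>rotating_mode \<kappa> a b c e t x\<bar> \<le> M" if "x \<in> unit_disk" for t x
  proof -
    have trig: "\<bar>p * cos z - q * sin z\<bar> \<le> \<bar>p\<bar> + \<bar>q\<bar>" "\<bar>p * cos z + q * sin z\<bar> \<le> \<bar>p\<bar> + \<bar>q\<bar>" for p q z :: real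
    proof -
      have "\<bar>p * cos z\<bar> \<le> \<bar>p\<bar>" "\<bar>q * sin z\<bar> \<le> \<bar>q\<bar>"
        by (simp_all add: abs_mult mult_left_le)
      then show "\<bar>p * cos z - q * sin z\<bar> \<le> \<bar>p\<bar> + \<bar>q\<bar>" "\<bar>p * cos z + q * sin z\<bar> \<le> \<bar>p\<bar> + \<bar>q\<bar>"
        by linarith+
    qed
    have "K * (\<bar>a\<bar> + \<bar>B t\<bar> + \<bar>C t\<bar>) \<le> K * (\<bar>a\<bar> + (\<bar>b\<bar> + \<bar>c\<bar>) + (\<bar>c\<bar> + \<bar>b\<bar>))"
      unfolding B_def C_def using K(1) by (intro mult_left_mono add_mono trig) auto
    then show ?thesis
      unfolding rm M_def using K(2)[OF that, of a "B t" "C t"] by linarith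
  qed
  have meas: "rotating_mode \<kappa> a b c e t \<in> borel_measurable disk_measure" for t
    by (rule disk_measurable_continuous[OF continuous_on_rotating_mode refl])
  have "rotating_mode \<kappa> a b c e 0 \<in> Linfty_space"
  proof -
    have "AE x in disk_measure. \<bar>rotating_mode \<kappa> a b c e 0 x\<bar> \<le> M"
      by (rule AE_I2) (simp add: bound)
    then show ?thesis
      unfolding Linfty_space_def using meas by blast
  qed
  moreover have "rotating_mode \<kappa> a b c e \<in> Linfty_Linfty"
  proof -
    have "continuous_on UNIV (\<lambda>p :: real \<times> (real^2). rotating_mode \<kappa> a b c e (fst p) (snd p))"
      unfolding rotating_mode_def divide_inverse by (auto intro!: continuous_intros)
    then have "(\<lambda>p. rotating_mode \<kappa> a b c e (fst p) (snd p)) \<in> borel_measurable (lebesgue_on (UNIV \<times> unit_disk))"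
      by (intro measurable_restrict_space1 measurable_completion) (simp add: borel_measurable_continuous_onI)
    then show ?thesis
      unfolding Linfty_Linfty_def case_prod_unfold
      by (auto intro!: exI[of _ M] AE_I2 bound)
  qed
  moreover have "continuous_Lp_curve s (rotating_mode \<kappa> a b c e)" if "1 \<le> s" for s
    unfolding continuous_Lp_curve_def
  proof (intro conjI allI)
    have s: "0 < s" using that by simp
    let ?c = "measure lebesgue (unit_disk :: (real^2) set) powr (1 / s)"
    fix t
    show "rotating_mode \<kappa> a b c e t \<in> Lp_space s"
      by (rule Lp_bounded(1)[OF meas bound s])
    have le: "Lp_norm s (\<lambda>x. rotating_mode \<kappa> a b c e t' x - rotating_mode \<kappa> a b c e t x)
        \<le> K * (\<bar>0\<bar> + \<bar>B t' - B t\<bar> + \<bar>C t' - C t\<bar>) * ?c" for t'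
    proof (rule Lp_bounded(2)[OF borel_measurable_diff[OF meas meas] _ s])
      fix x :: "real^2" assume x: "x \<in> unit_disk"
      have "rotating_mode \<kappa> a b c e t' x - rotating_mode \<kappa> a b c e t x
          = bessel_mode \<kappa> 0 (B t' - B t) (C t' - C t) (x $ 1) (x $ 2)"
        unfolding rm bessel_mode_def by (simp add: algebra_simps)
      then show "\<bar>rotating_mode \<kappa> a b c e t' x - rotating_mode \<kappa> a b c e t x\<bar>
          \<le> K * (\<bar>0\<bar> + \<bar>B t' - B t\<bar> + \<bar>C t' - C t\<bar>)"
        using K(2)[OF x, of 0 "B t' - B t" "C t' - C t"] by simp
    qed
    have "((\<lambda>t'. K * (\<bar>0\<bar> + \<bar>B t' - B t\<bar> + \<bar>C t' - C t\<bar>) * ?c) \<longlongrightarrow>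
        K * (\<bar>0\<bar> + \<bar>B t - B t\<bar> + \<bar>C t - C t\<bar>) * ?c) (at t)"
      unfolding B_def C_def by (intro tendsto_intros) auto
    then have "((\<lambda>t'. K * (\<bar>0\<bar> + \<bar>B t' - B t\<bar> + \<bar>C t' - C t\<bar>) * ?c) \<longlongrightarrow> 0) (at t)"
      by simp
    then show "((\<lambda>t'. Lp_norm s (\<lambda>x. rotating_mode \<kappa> a b c e t' x - rotating_mode \<kappa> a b c e t x)) \<longlongrightarrow> 0) (at t)"
      by (rule tendsto_sandwich[OF _ _ tendsto_const, rotated 2])
         (intro always_eventually allI Lp_norm_nonneg le)+
  qed
  ultimately show ?thesis
    unfolding yudovich_solution_def
    using weak_vorticity_equation_rotating_mode[OF assms] distribution_rotating_mode energy_rotating_mode[OF assms]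
    by auto
qed

lemma polar_coordinates:
  "norm x * cos (polar_angle x) = x $ 1" "norm x * sin (polar_angle x) = x $ 2"
proof -
  have "cmod (Complex (x $ 1) (x $ 2)) = norm x"
    using norm_vec2[of x] by (simp add: complex_norm) (metis norm_ge_zero real_sqrt_unique)
  then have "rcis (norm x) (polar_angle x) = Complex (x $ 1) (x $ 2)"
    unfolding polar_angle_def using rcis_cmod_Arg[of "Complex (x $ 1) (x $ 2)"] by simp
  then show "norm x * cos (polar_angle x) = x $ 1" "norm x * sin (polar_angle x) = x $ 2"
    by (simp_all add: complex_eq_iff)
qed

lemma polar_point_add_angle: "polar_point (norm x) (polar_angle x + \<beta>) = plane_rotation (- \<beta>) x"
proof -
  have "norm x * cos (polar_angle x + \<beta>) = x $ 1 * cos \<beta> - x $ 2 * sin \<beta>"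
    "norm x * sin (polar_angle x + \<beta>) = x $ 2 * cos \<beta> + x $ 1 * sin \<beta>"
    unfolding cos_add sin_add polar_coordinates[symmetric] by (simp_all add: algebra_simps)
  then show ?thesis
    by (simp add: polar_point_def vec_eq_iff forall_2)
qed

text \<open>The angle disappears because \<open>r cos \<theta>\<close> and \<open>r sin \<theta>\<close> are the Cartesian coordinates and
  \<open>J\<^sub>1(jr)\<close> carries a factor \<open>r\<close>; this also covers the origin, where the angle is a convention.\<close>

lemma V_space_bessel_mode:
  assumes "f \<in> V_space"
  obtains a b c where
    "\<And>x. x \<in> unit_disk \<Longrightarrow> f x = bessel_mode (bessel_zero\<^sup>2 / 4) a b c (x $ 1) (x $ 2)"
proof -
  obtain a b c where f: "\<And>x. x \<in> unit_disk \<Longrightarrow> f x = a * bessel_J 0 (bessel_zero * norm x)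
            + b * (bessel_J 1 (bessel_zero * norm x) * cos (polar_angle x))
            + c * (bessel_J 1 (bessel_zero * norm x) * sin (polar_angle x))"
    using assms unfolding V_space_def by blast
  show ?thesis
  proof (rule that)
    fix x :: "real^2" assume "x \<in> unit_disk"
    have arg: "(bessel_zero * norm x)\<^sup>2 / 4 = bessel_zero\<^sup>2 / 4 * ((x $ 1)\<^sup>2 + (x $ 2)\<^sup>2)"
      by (simp add: power_mult_distrib norm_vec2)
    have "f x = a * bessel_entire 0 ((bessel_zero * norm x)\<^sup>2 / 4)
        + bessel_entire 1 ((bessel_zero * norm x)\<^sup>2 / 4) * (b * bessel_zero / 2 * (norm x * cos (polar_angle x))
            + c * bessel_zero / 2 * (norm x * sin (polar_angle x)))"
      unfolding f[OF \<open>x \<in> unit_disk\<close>] bessel_J_eq_entire by (simp add: algebra_simps)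
    then show "f x = bessel_mode (bessel_zero\<^sup>2 / 4) a (b * bessel_zero / 2) (c * bessel_zero / 2) (x $ 1) (x $ 2)"
      unfolding arg polar_coordinates bessel_mode_def .
  qed
qed

theorem theorem6p2:
  fixes p :: real and \<omega>bar :: "real^2 \<Rightarrow> real"
  assumes "1 < p" and "\<omega>bar \<in> V_space"
  shows "\<exists>\<omega> :: nat \<Rightarrow> real \<Rightarrow> real^2 \<Rightarrow> real.
           (\<forall>n. \<exists>\<omega>0. yudovich_solution \<omega>0 (\<omega> n)) \<and>
           Lp_converges p (\<lambda>n. \<omega> n 0) \<omega>bar \<and>
           (\<forall>\<omega>tilde \<in> rotation_orbit \<omega>bar.
              \<exists>t :: nat \<Rightarrow> real. Lp_converges p (\<lambda>n. \<omega> n (t n)) \<omega>tilde)"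
proof -
  define \<kappa> where "\<kappa> = bessel_zero\<^sup>2 / 4"
  have \<kappa>: "0 < \<kappa>" "bessel_entire 1 \<kappa> = 0"
    using bessel_zero_spec by (simp_all add: \<kappa>_def)
  obtain a b c where \<omega>bar: "\<And>x. x \<in> unit_disk \<Longrightarrow> \<omega>bar x = bessel_mode \<kappa> a b c (x $ 1) (x $ 2)"
    using V_space_bessel_mode[OF assms(2)] unfolding \<kappa>_def by metis
  define e where "e n = inverse (real (Suc n))" for n
  have e: "e n \<noteq> 0" "e \<longlonglongrightarrow> 0" for n
    unfolding e_def using LIMSEQ_inverse_real_of_nat by auto
  define \<omega> where "\<omega> n = rotating_mode \<kappa> a b c (e n)" for n
  \<comment> \<open>At time \<open>2 s / e n\<close> the solution has turned by exactly the angle \<open>s\<close>.\<close>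
  have orbit: "Lp_converges p (\<lambda>n. \<omega> n (2 * s / e n)) g"
    if g: "\<And>x. x \<in> unit_disk \<Longrightarrow> g x = \<omega>bar (plane_rotation s x)" for s g
  proof (rule Lp_converges_add_null_constant)
    let ?G = "\<lambda>x :: real^2. bessel_mode \<kappa> a (b * cos s - c * sin s) (c * cos s + b * sin s) (x $ 1) (x $ 2)"
    show "continuous_on UNIV ?G" by (auto intro!: continuous_intros)
    show "g x = ?G x" if "x \<in> unit_disk" for x
      unfolding g[OF that] bessel_mode_plane_rotation
      using that plane_rotation_in_disk by (intro \<omega>bar) blast
    show "\<omega> n (2 * s / e n) x = ?G x + e n" for n x
      using e(1)[of n] by (simp add: \<omega>_def rotating_mode_def)
  qed (use e assms(1) in auto)
  have "\<forall>n. \<exists>\<omega>0. yudovich_solution \<omega>0 (\<omega> n)"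
    unfolding \<omega>_def using yudovich_solution_rotating_mode[OF \<kappa>] by blast
  moreover have "Lp_converges p (\<lambda>n. \<omega> n 0) \<omega>bar"
  proof -
    have "plane_rotation 0 x = x" for x
      by (simp add: vec_eq_iff forall_2)
    then show ?thesis using orbit[of \<omega>bar 0] by simp
  qed
  moreover have "\<exists>t :: nat \<Rightarrow> real. Lp_converges p (\<lambda>n. \<omega> n (t n)) \<omega>tilde"
    if member: "\<omega>tilde \<in> rotation_orbit \<omega>bar" for \<omega>tilde
  proof -
    obtain \<beta> where "\<omega>tilde = (\<lambda>x. \<omega>bar (polar_point (norm x) (polar_angle x + \<beta>)))"
      using member unfolding rotation_orbit_def by blast
    then have "\<omega>tilde x = \<omega>bar (plane_rotation (- \<beta>) x)" for x
      by (simp add: polar_point_add_angle)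
    then show ?thesis
      by (intro exI[of _ "\<lambda>n. 2 * (- \<beta>) / e n"] orbit)
  qed
  ultimately show ?thesis by blast
qed

end
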